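(* Given any finite constant specification $\mathsf{CS}$ for $\mathsf{S4LP}$, and any sequent $\Gamma\Rightarrow\Delta$ in the language of $\mathsf{G3S4LP}$, it is decidable whether the sequent is derivable in $\mathsf{G3S4LP}_{\mathsf{CS}}$.
   Context: Logic $\mathsf{S4LP}$. Terms are built from justification variables and constants by binary $\cdot,+$ and unary $!$. Formulas are built from propositional variables and $\bot$ by $\neg,\wedge,\vee,\to$, $t:A$ ($t$ a term) and $\Box A$. Axiom schemes: propositional tautologies; $\Box(A\to B)\to(\Box A\to\Box B)$; $\Box A\to A$; $\Box A\to\Box\Box A$; $s:A\to(s+t):A$, $s:A\to(t+s):A$; $s:(A\to B)\to(t:A\to(s\cdot t):B)$; $t:A\to A$; $t:A\to\,!t:t:A$; $t:A\to\Box A$. A constant specification $\mathsf{CS}$ for $\mathsf{S4LP}$ is a set of formulas $c:A$ with $c$ a constant and $A$ an axiom instance. Calculus $\mathsf{G3S4LP}_{\mathsf{CS}}$. Fix a countably infinite set of labels $w,v,u,\dots$. The labeled language has labeled formulas $w\Vvdash A$, relational atoms $wRv$ and evidence atoms $wE(t,A)$ ($A$ a formula of $\mathsf{S4LP}$, $t$ a term). Sequents $\Gamma\Rightarrow\Delta$ consist of finite multisets of these. Initial sequents: $w\Vvdash P,\Gamma\Rightarrow\Delta,w\Vvdash P$ ($P$ a propositional variable); $w\Vvdash\bot,\Gamma\Rightarrow\Delta$; $wRv,\Gamma\Rightarrow\Delta,wRv$; $wE(t,A),\Gamma\Rightarrow\Delta,wE(t,A)$. Rules (premises / conclusion): (L$\neg$)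 $\Gamma\Rightarrow\Delta,w\Vvdash A$ / $w\Vvdash\neg A,\Gamma\Rightarrow\Delta$; (R$\neg$) $w\Vvdash A,\Gamma\Rightarrow\Delta$ / $\Gamma\Rightarrow\Delta,w\Vvdash\neg A$; (L$\wedge$) $w\Vvdash A,w\Vvdash B,\Gamma\Rightarrow\Delta$ / $w\Vvdash A\wedge B,\Gamma\Rightarrow\Delta$; (R$\wedge$) $\Gamma\Rightarrow\Delta,w\Vvdash A$ and $\Gamma\Rightarrow\Delta,w\Vvdash B$ / $\Gamma\Rightarrow\Delta,w\Vvdash A\wedge B$; (L$\vee$) $w\Vvdash A,\Gamma\Rightarrow\Delta$ and $w\Vvdash B,\Gamma\Rightarrow\Delta$ / $w\Vvdash A\vee B,\Gamma\Rightarrow\Delta$; (R$\vee$) $\Gamma\Rightarrow\Delta,w\Vvdash A,w\Vvdash B$ / $\Gamma\Rightarrow\Delta,w\Vvdash A\vee B$; (L$\to$) $\Gamma\Rightarrow\Delta,w\Vvdash A$ and $w\Vvdash B,\Gamma\Rightarrow\Delta$ / $w\Vvdash A\to B,\Gamma\Rightarrow\Delta$; (R$\to$) $w\Vvdash A,\Gamma\Rightarrow\Delta,w\Vvdash B$ / $\Gamma\Rightarrow\Delta,w\Vvdash A\to B$; (L$\Box$) $v\Vvdash A,w\Vvdash\Box A,wRv,\Gamma\Rightarrow\Delta$ / $w\Vvdash\Box A,wRv,\Gamma\Rightarrow\Delta$; (R$\Box$) $wRv,\Gamma\Rightarrow\Delta,v\Vvdash A$ / $\Gamma\Rightarrow\Delta,w\Vvdash\Box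 A$, where $v$ does not occur in the conclusion; (L:) $v\Vvdash A,w\Vvdash t:A,wRv,\Gamma\Rightarrow\Delta$ / $w\Vvdash t:A,wRv,\Gamma\Rightarrow\Delta$; (R:) $wRv,wE(t,A),\Gamma\Rightarrow\Delta,v\Vvdash A$ / $wE(t,A),\Gamma\Rightarrow\Delta,w\Vvdash t:A$, where $v$ does not occur in the conclusion; (E) $wE(t,A),w\Vvdash t:A,\Gamma\Rightarrow\Delta$ / $w\Vvdash t:A,\Gamma\Rightarrow\Delta$; (El+) $wE(s+t,A),wE(t,A),\Gamma\Rightarrow\Delta$ / $wE(t,A),\Gamma\Rightarrow\Delta$; (Er+) $wE(t+s,A),wE(t,A),\Gamma\Rightarrow\Delta$ / $wE(t,A),\Gamma\Rightarrow\Delta$; (E$\cdot$) $wE(s\cdot t,B),wE(s,A\to B),wE(t,A),\Gamma\Rightarrow\Delta$ / $wE(s,A\to B),wE(t,A),\Gamma\Rightarrow\Delta$; (E!) $wE(!t,t:A),wE(t,A),\Gamma\Rightarrow\Delta$ / $wE(t,A),\Gamma\Rightarrow\Delta$; (Mon) $vE(t,A),wE(t,A),wRv,\Gamma\Rightarrow\Delta$ / $wE(t,A),wRv,\Gamma\Rightarrow\Delta$; (AN) $wE(c,A),\Gamma\Rightarrow\Delta$ / $\Gamma\Rightarrow\Delta$, for $c:A\in\mathsf{CS}$; (Ref) $wRw,\Gamma\Rightarrow\Delta$ / $\Gamma\Rightarrow\Delta$; (Trans) $wRu,wRv,vRu,\Gamma\Rightarrow\Delta$ / $wRv,vRu,\Gamma\Rightarrow\Delta$.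 *)

theory Defs
  imports Main "HOL-Library.Multiset" "HOL-Library.Nat_Bijection"
begin

section \<open>Decidability\<close>

text \<open>
  Total recursive functions in the sense of Kleene and Shoenfield: minimization is applied to
  regular functions only, so no partial functions arise. \<open>recursive k f\<close> says that \<open>f\<close>,
  restricted to argument lists of length \<open>k\<close>, is a recursive function of arity \<open>k\<close>; the values
  of \<open>f\<close> on lists of any other length are junk and are never used.
\<close>

inductive recursive :: "nat \<Rightarrow> (nat list \<Rightarrow> nat) \<Rightarrow> bool" where
  zero: "recursive k (\<lambda>xs. 0)"
| succ: "recursive 1 (\<lambda>xs. Suc (xs ! 0))"
| proj: "i < k \<Longrightarrow> recursive k (\<lambda>xs. xs ! i)"
| comp: "recursive (length gs) f \<Longrightarrow> (\<And>g. g \<in> set gs \<Longrightarrow> recursive k g) \<Longrightarrow>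
    recursive k (\<lambda>xs. f (map (\<lambda>g. g xs) gs))"
| prim: "recursive k g \<Longrightarrow> recursive (Suc (Suc k)) h \<Longrightarrow>
    recursive (Suc k) (\<lambda>xs. rec_nat (g (tl xs)) (\<lambda>n r. h (n # r # tl xs)) (hd xs))"
| mini: "recursive (Suc k) f \<Longrightarrow> (\<And>xs. length xs = k \<Longrightarrow> \<exists>y. f (y # xs) = 0) \<Longrightarrow>
    recursive k (\<lambda>xs. LEAST y. f (y # xs) = 0)"

text \<open>
  \<open>codes n x\<close> means that \<open>n\<close> is a code of the problem instance \<open>x\<close>. An instance may have several
  codes (a finite set or multiset is coded by any list enumerating it), and the decision
  procedure must answer correctly on each of them. The definition is meaningful when every
  instance has a code and no number codes two instances; both are proved for the coding below.
\<close>

definition decidable :: "(nat \<Rightarrow> 'a \<Rightarrow> bool) \<Rightarrow> 'a set \<Rightarrow> ('a \<Rightarrow> bool) \<Rightarrow> bool" where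
  "decidable codes D P \<longleftrightarrow>
    (\<exists>f. recursive 1 f \<and> (\<forall>x\<in>D. \<forall>n. codes n x \<longrightarrow> f [n] = (if P x then 1 else 0)))"


section \<open>The language and axioms of S4LP\<close>

datatype tm = JVar nat | JConst nat | App tm tm | Plus tm tm | Bang tm

datatype fm =
    PVar nat
  | Bot
  | Neg fm
  | Conj fm fm
  | Disj fm fm
  | Imp fm fm
  | Just tm fm  \<comment> \<open>\<open>t : A\<close>\<close>
  | Box fm

text \<open>Propositional evaluation, with \<open>t : A\<close> and \<open>\<box>A\<close> treated as atoms.\<close>

fun peval :: "(fm \<Rightarrow> bool) \<Rightarrow> fm \<Rightarrow> bool" where
  "peval v (PVar p) = v (PVar p)"
| "peval v Bot = False"
| "peval v (Neg A) = (\<not> peval v A)"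
| "peval v (Conj A B) = (peval v A \<and> peval v B)"
| "peval v (Disj A B) = (peval v A \<or> peval v B)"
| "peval v (Imp A B) = (peval v A \<longrightarrow> peval v B)"
| "peval v (Just t A) = v (Just t A)"
| "peval v (Box A) = v (Box A)"

inductive S4LP_axiom :: "fm \<Rightarrow> bool" where
  taut: "(\<And>v. peval v A) \<Longrightarrow> S4LP_axiom A"
| box_K: "S4LP_axiom (Imp (Box (Imp A B)) (Imp (Box A) (Box B)))"
| box_T: "S4LP_axiom (Imp (Box A) A)"
| box_4: "S4LP_axiom (Imp (Box A) (Box (Box A)))"
| just_plus1: "S4LP_axiom (Imp (Just s A) (Just (Plus s t) A))"
| just_plus2: "S4LP_axiom (Imp (Just s A) (Just (Plus t s) A))"
| just_app: "S4LP_axiom (Imp (Just s (Imp A B)) (Imp (Just t A) (Just (App s t) B)))"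
| just_T: "S4LP_axiom (Imp (Just t A) A)"
| just_4: "S4LP_axiom (Imp (Just t A) (Just (Bang t) (Just t A)))"
| just_box: "S4LP_axiom (Imp (Just t A) (Box A))"

definition constant_specification :: "fm set \<Rightarrow> bool" where
  "constant_specification CS \<longleftrightarrow> (\<forall>F\<in>CS. \<exists>c A. F = Just (JConst c) A \<and> S4LP_axiom A)"


section \<open>The labeled calculus G3S4LP\<close>

type_synonym label = nat

datatype lfm =
    Forces label fm   \<comment> \<open>\<open>w \<tturnstile> A\<close>\<close>
  | Rel label label   \<comment> \<open>\<open>w R v\<close>\<close>
  | Ev label tm fm    \<comment> \<open>\<open>w E(t, A)\<close>\<close>

fun labels :: "lfm \<Rightarrow> label set" where
  "labels (Forces w A) = {w}"
| "labels (Rel w v) = {w, v}"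
| "labels (Ev w t A) = {w}"

definition fresh :: "label \<Rightarrow> lfm multiset \<Rightarrow> lfm multiset \<Rightarrow> bool" where
  "fresh v \<Gamma> \<Delta> \<longleftrightarrow> (\<forall>X \<in># \<Gamma> + \<Delta>. v \<notin> labels X)"

inductive G3S4LP :: "fm set \<Rightarrow> lfm multiset \<Rightarrow> lfm multiset \<Rightarrow> bool" for CS :: "fm set" where
  InitP: "G3S4LP CS (add_mset (Forces w (PVar p)) \<Gamma>) (add_mset (Forces w (PVar p)) \<Delta>)"
| InitBot: "G3S4LP CS (add_mset (Forces w Bot) \<Gamma>) \<Delta>"
| InitR: "G3S4LP CS (add_mset (Rel w v) \<Gamma>) (add_mset (Rel w v) \<Delta>)"
| InitE: "G3S4LP CS (add_mset (Ev w t A) \<Gamma>) (add_mset (Ev w t A) \<Delta>)"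
| LNeg: "G3S4LP CS \<Gamma> (add_mset (Forces w A) \<Delta>) \<Longrightarrow>
    G3S4LP CS (add_mset (Forces w (Neg A)) \<Gamma>) \<Delta>"
| RNeg: "G3S4LP CS (add_mset (Forces w A) \<Gamma>) \<Delta> \<Longrightarrow>
    G3S4LP CS \<Gamma> (add_mset (Forces w (Neg A)) \<Delta>)"
| LConj: "G3S4LP CS (add_mset (Forces w A) (add_mset (Forces w B) \<Gamma>)) \<Delta> \<Longrightarrow>
    G3S4LP CS (add_mset (Forces w (Conj A B)) \<Gamma>) \<Delta>"
| RConj: "G3S4LP CS \<Gamma> (add_mset (Forces w A) \<Delta>) \<Longrightarrow> G3S4LP CS \<Gamma> (add_mset (Forces w B) \<Delta>) \<Longrightarrow>
    G3S4LP CS \<Gamma> (add_mset (Forces w (Conj A B)) \<Delta>)"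
| LDisj: "G3S4LP CS (add_mset (Forces w A) \<Gamma>) \<Delta> \<Longrightarrow> G3S4LP CS (add_mset (Forces w B) \<Gamma>) \<Delta> \<Longrightarrow>
    G3S4LP CS (add_mset (Forces w (Disj A B)) \<Gamma>) \<Delta>"
| RDisj: "G3S4LP CS \<Gamma> (add_mset (Forces w A) (add_mset (Forces w B) \<Delta>)) \<Longrightarrow>
    G3S4LP CS \<Gamma> (add_mset (Forces w (Disj A B)) \<Delta>)"
| LImp: "G3S4LP CS \<Gamma> (add_mset (Forces w A) \<Delta>) \<Longrightarrow> G3S4LP CS (add_mset (Forces w B) \<Gamma>) \<Delta> \<Longrightarrow>
    G3S4LP CS (add_mset (Forces w (Imp A B)) \<Gamma>) \<Delta>"
| RImp: "G3S4LP CS (add_mset (Forces w A) \<Gamma>) (add_mset (Forces w B) \<Delta>) \<Longrightarrow>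
    G3S4LP CS \<Gamma> (add_mset (Forces w (Imp A B)) \<Delta>)"
| LBox: "G3S4LP CS
      (add_mset (Forces v A) (add_mset (Forces w (Box A)) (add_mset (Rel w v) \<Gamma>))) \<Delta> \<Longrightarrow>
    G3S4LP CS (add_mset (Forces w (Box A)) (add_mset (Rel w v) \<Gamma>)) \<Delta>"
| RBox: "G3S4LP CS (add_mset (Rel w v) \<Gamma>) (add_mset (Forces v A) \<Delta>) \<Longrightarrow>
    fresh v \<Gamma> (add_mset (Forces w (Box A)) \<Delta>) \<Longrightarrow>
    G3S4LP CS \<Gamma> (add_mset (Forces w (Box A)) \<Delta>)"
| LJust: "G3S4LP CS
      (add_mset (Forces v A) (add_mset (Forces w (Just t A)) (add_mset (Rel w v) \<Gamma>))) \<Delta> \<Longrightarrow>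
    G3S4LP CS (add_mset (Forces w (Just t A)) (add_mset (Rel w v) \<Gamma>)) \<Delta>"
| RJust: "G3S4LP CS (add_mset (Rel w v) (add_mset (Ev w t A) \<Gamma>)) (add_mset (Forces v A) \<Delta>) \<Longrightarrow>
    fresh v (add_mset (Ev w t A) \<Gamma>) (add_mset (Forces w (Just t A)) \<Delta>) \<Longrightarrow>
    G3S4LP CS (add_mset (Ev w t A) \<Gamma>) (add_mset (Forces w (Just t A)) \<Delta>)"
| E: "G3S4LP CS (add_mset (Ev w t A) (add_mset (Forces w (Just t A)) \<Gamma>)) \<Delta> \<Longrightarrow>
    G3S4LP CS (add_mset (Forces w (Just t A)) \<Gamma>) \<Delta>"
| ElPlus: "G3S4LP CS (add_mset (Ev w (Plus s t) A) (add_mset (Ev w t A) \<Gamma>)) \<Delta> \<Longrightarrow>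
    G3S4LP CS (add_mset (Ev w t A) \<Gamma>) \<Delta>"
| ErPlus: "G3S4LP CS (add_mset (Ev w (Plus t s) A) (add_mset (Ev w t A) \<Gamma>)) \<Delta> \<Longrightarrow>
    G3S4LP CS (add_mset (Ev w t A) \<Gamma>) \<Delta>"
| EApp: "G3S4LP CS
      (add_mset (Ev w (App s t) B) (add_mset (Ev w s (Imp A B)) (add_mset (Ev w t A) \<Gamma>))) \<Delta> \<Longrightarrow>
    G3S4LP CS (add_mset (Ev w s (Imp A B)) (add_mset (Ev w t A) \<Gamma>)) \<Delta>"
| EBang: "G3S4LP CS (add_mset (Ev w (Bang t) (Just t A)) (add_mset (Ev w t A) \<Gamma>)) \<Delta> \<Longrightarrow>
    G3S4LP CS (add_mset (Ev w t A) \<Gamma>) \<Delta>"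
| Mon: "G3S4LP CS
      (add_mset (Ev v t A) (add_mset (Ev w t A) (add_mset (Rel w v) \<Gamma>))) \<Delta> \<Longrightarrow>
    G3S4LP CS (add_mset (Ev w t A) (add_mset (Rel w v) \<Gamma>)) \<Delta>"
| AN: "G3S4LP CS (add_mset (Ev w (JConst c) A) \<Gamma>) \<Delta> \<Longrightarrow> Just (JConst c) A \<in> CS \<Longrightarrow>
    G3S4LP CS \<Gamma> \<Delta>"
| Ref: "G3S4LP CS (add_mset (Rel w w) \<Gamma>) \<Delta> \<Longrightarrow> G3S4LP CS \<Gamma> \<Delta>"
| Trans: "G3S4LP CS (add_mset (Rel w u) (add_mset (Rel w v) (add_mset (Rel v u) \<Gamma>))) \<Delta> \<Longrightarrow>
    G3S4LP CS (add_mset (Rel w v) (add_mset (Rel v u) \<Gamma>)) \<Delta>"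


section \<open>Coding of problem instances\<close>

fun tm_code :: "tm \<Rightarrow> nat" where
  "tm_code (JVar n) = prod_encode (0, n)"
| "tm_code (JConst n) = prod_encode (1, n)"
| "tm_code (App s t) = prod_encode (2, prod_encode (tm_code s, tm_code t))"
| "tm_code (Plus s t) = prod_encode (3, prod_encode (tm_code s, tm_code t))"
| "tm_code (Bang t) = prod_encode (4, tm_code t)"

fun fm_code :: "fm \<Rightarrow> nat" where
  "fm_code (PVar n) = prod_encode (0, n)"
| "fm_code Bot = prod_encode (1, 0)"
| "fm_code (Neg A) = prod_encode (2, fm_code A)"
| "fm_code (Conj A B) = prod_encode (3, prod_encode (fm_code A, fm_code B))"
| "fm_code (Disj A B) = prod_encode (4, prod_encode (fm_code A, fm_code B))"
| "fm_code (Imp A B) = prod_encode (5, prod_encode (fm_code A, fm_code B))"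
| "fm_code (Just t A) = prod_encode (6, prod_encode (tm_code t, fm_code A))"
| "fm_code (Box A) = prod_encode (7, fm_code A)"

fun lfm_code :: "lfm \<Rightarrow> nat" where
  "lfm_code (Forces w A) = prod_encode (0, prod_encode (w, fm_code A))"
| "lfm_code (Rel w v) = prod_encode (1, prod_encode (w, v))"
| "lfm_code (Ev w t A) = prod_encode (2, prod_encode (w, prod_encode (tm_code t, fm_code A)))"

definition instance_code ::
  "nat \<Rightarrow> fm set \<times> lfm multiset \<times> lfm multiset \<Rightarrow> bool" where
  "instance_code n = (\<lambda>(CS, \<Gamma>, \<Delta>). \<exists>cs gs ds. CS = set cs \<and> \<Gamma> = mset gs \<and> \<Delta> = mset ds \<and>
    n = list_encode [list_encode (map fm_code cs),
      list_encode (map lfm_code gs), list_encode (map lfm_code ds)])"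

lemma tm_code_inject: "tm_code s = tm_code t \<Longrightarrow> s = t"
proof (induction s arbitrary: t)
  case (JVar n) then show ?case by (cases t) auto
next
  case (JConst n) then show ?case by (cases t) auto
next
  case (App s1 s2) then show ?case by (cases t) auto
next
  case (Plus s1 s2) then show ?case by (cases t) auto
next
  case (Bang s) then show ?case by (cases t) auto
qed

lemma fm_code_inject: "fm_code A = fm_code B \<Longrightarrow> A = B"
proof (induction A arbitrary: B)
  case (PVar n) then show ?case by (cases B) auto
next
  case Bot then show ?case by (cases B) auto
next
  case (Neg A) then show ?case by (cases B) auto
next
  case (Conj A1 A2) then show ?case by (cases B) auto
next
  case (Disj A1 A2) then show ?case by (cases B) auto
next
  case (Imp A1 A2) then show ?case by (cases B) auto
next
  case (Just t A) then show ?case by (cases B) (auto dest: tm_code_inject)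
next
  case (Box A) then show ?case by (cases B) auto
qed

lemma lfm_code_inject: "lfm_code X = lfm_code Y \<Longrightarrow> X = Y"
  by (cases X; cases Y) (auto dest: tm_code_inject fm_code_inject)

lemma instance_code_exists:
  assumes "finite CS"
  shows "\<exists>n. instance_code n (CS, \<Gamma>, \<Delta>)"
proof -
  obtain cs where "CS = set cs" using assms finite_list by metis
  moreover obtain gs where "\<Gamma> = mset gs" by (metis ex_mset)
  moreover obtain ds where "\<Delta> = mset ds" by (metis ex_mset)
  ultimately show ?thesis unfolding instance_code_def by auto
qed

lemma instance_code_unique:
  assumes "instance_code n x" and "instance_code n y"
  shows "x = y"
proof -
  have "inj fm_code" and "inj lfm_code"
    by (auto intro: injI fm_code_inject lfm_code_inject)
  then show ?thesis using assms
    by (auto simp: instance_code_def list_encode_eq inj_map_eq_map simp del: list_encode.simps)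
qed

end

theory Submission
  imports Defs
begin

text \<open>
  A sequent is underivable iff it has a countermodel, and countermodels can be taken finite of
  size bounded by a recursive function of the code \<open>n\<close> of the instance. From an underivable
  sequent, fair root-first proof search yields an infinite branch whose union is a saturated pair
  \<open>(G, D)\<close> of sets of labeled formulas; no contraction is needed, since the search works on the
  multisets themselves. The branch is filtrated: a label is replaced by the finite set of the
  formulas, evidence facts and input labels with codes below \<open>n\<close> that it satisfies. Conversely, a
  finite family of such sets with local coherence conditions (a quasi-model) gives a Kripke model
  once its evidence is closed under the operations on terms, and the calculus is sound for Kripke
  models. The quasi-models of an instance are described by bounded quantification over numbers.
\<close>

section \<open>Closure properties of recursive functions\<close>

text \<open>The number \<open>n\<close> takes the place of a subformula closure: all codes occurring
  in the instance lie below \<open>n\<close>, and subterms and subformulas have smaller codes, so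
  the numbers below \<open>n\<close> are closed under decomposition and no syntactic closure has to
  be computed. The obstacle is evidence. Its closure under the operations on terms is infinite, and
  under \<open>Bang\<close> it leaves every bounded set of formulas, yet refuting an evidence atom
  depends on evidence being absent. A finite world can record only evidence between codes below
  \<open>n\<close>; the crucial point is that closing it up afterwards creates nothing new in that
  range. Evidence flows from terms to larger terms, so a small term can obtain it only from smaller
  ones. The two sides of a sequent are recorded by separate items because a world need not decide
  every formula; truth is then a pair of one-way implications.\<close>

definition recfn :: "nat \<Rightarrow> (nat list \<Rightarrow> nat) \<Rightarrow> bool" where
  "recfn k f \<longleftrightarrow> (\<exists>g. recursive k g \<and> (\<forall>xs. length xs = k \<longrightarrow> f xs = g xs))"

definition recpred :: "nat \<Rightarrow> (nat list \<Rightarrow> bool) \<Rightarrow> bool" where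
  "recpred k P \<longleftrightarrow> recfn k (\<lambda>xs. if P xs then 1 else 0)"

lemma recfnI: "recursive k g \<Longrightarrow> (\<And>xs. length xs = k \<Longrightarrow> f xs = g xs) \<Longrightarrow> recfn k f"
  unfolding recfn_def by blast

text \<open>This closure is the reason for \<open>recfn\<close>: \<open>recursive\<close> fixes the
  junk values on lists of other lengths and is not closed under changing them.\<close>

lemma recfn_cong: "recfn k g \<Longrightarrow> (\<And>xs. length xs = k \<Longrightarrow> f xs = g xs) \<Longrightarrow> recfn k f"
  unfolding recfn_def by auto

lemma recpred_cong: "recpred k Q \<Longrightarrow> (\<And>xs. length xs = k \<Longrightarrow> P xs = Q xs) \<Longrightarrow> recpred k P"
  unfolding recpred_def by (erule recfn_cong) auto

lemma recfn_comp:
  assumes h: "recfn (length fs) h" and fs: "\<And>f. f \<in> set fs \<Longrightarrow> recfn k f"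
  shows "recfn k (\<lambda>xs. h (map (\<lambda>f. f xs) fs))"
proof -
  obtain h' where h': "recursive (length fs) h'" "\<And>xs. length xs = length fs \<Longrightarrow> h xs = h' xs"
    using h unfolding recfn_def by blast
  have "\<forall>f\<in>set fs. \<exists>g. recursive k g \<and> (\<forall>xs. length xs = k \<longrightarrow> f xs = g xs)"
    using fs unfolding recfn_def by blast
  then obtain G where G: "\<And>f. f \<in> set fs \<Longrightarrow> recursive k (G f)"
      "\<And>f xs. f \<in> set fs \<Longrightarrow> length xs = k \<Longrightarrow> f xs = G f xs"
    by metis
  have "recursive k (\<lambda>xs. h' (map (\<lambda>g. g xs) (map G fs)))"
    using h'(1) G(1) by (intro recursive.comp) auto
  then show ?thesis
  proof (rule recfnI)
    fix xs :: "nat list" assume "length xs = k"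
    then have "map (\<lambda>f. f xs) fs = map (\<lambda>g. g xs) (map G fs)" using G(2) by auto
    then show "h (map (\<lambda>f. f xs) fs) = h' (map (\<lambda>g. g xs) (map G fs))"
      using h'(2)[of "map (\<lambda>f. f xs) fs"] by (simp del: map_map)
  qed
qed

lemma recfn_prim:
  assumes g: "recfn k g" and h: "recfn (Suc (Suc k)) (\<lambda>xs. h (hd xs) (hd (tl xs)) (tl (tl xs)))"
  shows "recfn (Suc k) (\<lambda>xs. rec_nat (g (tl xs)) (\<lambda>n r. h n r (tl xs)) (hd xs))"
proof -
  obtain g' where g': "recursive k g'" "\<And>xs. length xs = k \<Longrightarrow> g xs = g' xs"
    using g unfolding recfn_def by blast
  obtain h' where h': "recursive (Suc (Suc k)) h'"
      "\<And>xs. length xs = Suc (Suc k) \<Longrightarrow> h (hd xs) (hd (tl xs)) (tl (tl xs)) = h' xs"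
    using h unfolding recfn_def by blast
  have h'': "h n r ys = h' (n # r # ys)" if "length ys = k" for n r ys
    using h'(2)[of "n # r # ys"] that by simp
  from recursive.prim[OF g'(1) h'(1)] show ?thesis
    by (rule recfnI) (simp add: g'(2) h'')
qed

lemma recfn_mini:
  assumes f: "recfn (Suc k) (\<lambda>xs. f (tl xs) (hd xs))"
    and ex: "\<And>xs. length xs = k \<Longrightarrow> \<exists>y. f xs y = 0"
  shows "recfn k (\<lambda>xs. LEAST y. f xs y = 0)"
proof -
  obtain f' where f': "recursive (Suc k) f'" "\<And>xs. length xs = Suc k \<Longrightarrow> f (tl xs) (hd xs) = f' xs"
    using f unfolding recfn_def by blast
  have eq: "f xs y = f' (y # xs)" if "length xs = k" for xs y
    using f'(2)[of "y # xs"] that by simp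
  have "recursive k (\<lambda>xs. LEAST y. f' (y # xs) = 0)"
    using f'(1) ex eq by (intro recursive.mini) auto
  then show ?thesis by (rule recfnI) (simp add: eq)
qed

lemma recfn_hd: "recfn (Suc k) hd"
  by (rule recfnI[OF recursive.proj[of 0]]) (auto simp: length_Suc_conv)

lemma recfn_tl:
  assumes "recfn k f" shows "recfn (Suc k) (\<lambda>xs. f (tl xs))"
proof -
  let ?fs = "map (\<lambda>i xs. xs ! Suc i) [0..<k]"
  have "recfn (Suc k) (\<lambda>xs. f (map (\<lambda>f. f xs) ?fs))"
    using assms by (intro recfn_comp) (auto intro!: recfnI[OF recursive.proj[of "Suc _"]])
  then show ?thesis
  proof (rule recfn_cong)
    fix xs :: "nat list" assume "length xs = Suc k"
    then have "tl xs = map (\<lambda>f. f xs) ?fs"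
      by (intro nth_equalityI) (auto simp: nth_tl)
    then show "f (tl xs) = f (map (\<lambda>f. f xs) ?fs)" by simp
  qed
qed

lemma recfn_comp1:
  assumes "recfn (Suc 0) (\<lambda>xs. h (hd xs))" and "recfn k f"
  shows "recfn k (\<lambda>xs. h (f xs))"
  using recfn_comp[of "[f]" "\<lambda>xs. h (hd xs)" k] assms by simp

lemma recfn_comp2:
  assumes "recfn (Suc (Suc 0)) (\<lambda>xs. h (hd xs) (hd (tl xs)))" and "recfn k f" and "recfn k g"
  shows "recfn k (\<lambda>xs. h (f xs) (g xs))"
  using recfn_comp[of "[f, g]" "\<lambda>xs. h (hd xs) (hd (tl xs))" k] assms by auto

lemma recpred_comp2:
  assumes "recpred (Suc (Suc 0)) (\<lambda>xs. P (hd xs) (hd (tl xs)))" and "recfn k f" and "recfn k g"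
  shows "recpred k (\<lambda>xs. P (f xs) (g xs))"
  using recfn_comp2[of "\<lambda>x y. if P x y then 1 else 0"] assms unfolding recpred_def by auto

text \<open>Arguments are addressed like de Bruijn indices, by \<open>hd\<close> after some number
  of \<open>tl\<close>. A bounded quantifier puts its variable in front of the list, so a formula is
  treated by descending through its syntax.\<close>

lemmas recfn_var0 = recfn_hd
lemmas recfn_var1 = recfn_tl[OF recfn_var0]
lemmas recfn_var2 = recfn_tl[OF recfn_var1]
lemmas recfn_var3 = recfn_tl[OF recfn_var2]
lemmas recfn_var4 = recfn_tl[OF recfn_var3]
lemmas recfn_var5 = recfn_tl[OF recfn_var4]
lemmas recfn_var6 = recfn_tl[OF recfn_var5]
lemmas recfn_var7 = recfn_tl[OF recfn_var6]
lemmas recfn_var8 = recfn_tl[OF recfn_var7]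
lemmas recfn_var9 = recfn_tl[OF recfn_var8]
lemmas recfn_vars = recfn_var0 recfn_var1 recfn_var2 recfn_var3 recfn_var4 recfn_var5 recfn_var6
  recfn_var7 recfn_var8 recfn_var9

lemma recfn_Suc0: "recfn k f \<Longrightarrow> recfn k (\<lambda>xs. Suc (f xs))"
  by (rule recfn_comp1[of Suc], rule recfnI[OF recursive.succ[simplified]]) (auto simp: length_Suc_conv)

lemma recfn_const: "recfn k (\<lambda>xs. c)"
proof (induction c)
  case 0 show ?case by (rule recfnI[OF recursive.zero]) simp
next
  case (Suc c) then show ?case by (rule recfn_Suc0)
qed

lemma recfn_add:
  assumes "recfn k f" "recfn k g" shows "recfn k (\<lambda>xs. f xs + g xs)"
proof (rule recfn_comp2[OF _ assms])
  have *: "rec_nat y (\<lambda>n r. Suc r) x = x + y" for x y by (induction x) auto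
  show "recfn (Suc (Suc 0)) (\<lambda>xs. hd xs + hd (tl xs))"
    using recfn_prim[of "Suc 0" hd "\<lambda>n r ys. Suc r"] by (simp add: * recfn_vars recfn_Suc0)
qed

lemma recfn_mult:
  assumes "recfn k f" "recfn k g" shows "recfn k (\<lambda>xs. f xs * g xs)"
proof (rule recfn_comp2[OF _ assms])
  have *: "rec_nat 0 (\<lambda>n r. r + y) x = x * y" for x y :: nat by (induction x) auto
  show "recfn (Suc (Suc 0)) (\<lambda>xs. hd xs * hd (tl xs))"
    using recfn_prim[of "Suc 0" "\<lambda>_. 0" "\<lambda>n r ys. r + hd ys"]
    by (simp add: * recfn_vars recfn_const recfn_add)
qed

lemma recfn_power:
  assumes "recfn k f" "recfn k g" shows "recfn k (\<lambda>xs. f xs ^ g xs)"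
proof (rule recfn_comp2[OF _ assms(2,1)])
  have *: "rec_nat (Suc 0) (\<lambda>n r. r * y) x = y ^ x" for x y :: nat by (induction x) auto
  show "recfn (Suc (Suc 0)) (\<lambda>xs. hd (tl xs) ^ hd xs)"
    using recfn_prim[of "Suc 0" "\<lambda>_. Suc 0" "\<lambda>n r ys. r * hd ys"]
    by (simp add: * recfn_vars recfn_const recfn_mult)
qed

lemma recfn_pred:
  assumes "recfn k f" shows "recfn k (\<lambda>xs. f xs - 1)"
proof (rule recfn_comp1[OF _ assms])
  have *: "rec_nat 0 (\<lambda>n r. n) x = x - 1" for x :: nat by (cases x) auto
  show "recfn (Suc 0) (\<lambda>xs. hd xs - 1)"
    using recfn_prim[of 0 "\<lambda>_. 0" "\<lambda>n r ys. n"]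
    by (simp add: * recfn_vars recfn_const)
qed

lemma recfn_diff:
  assumes "recfn k f" "recfn k g" shows "recfn k (\<lambda>xs. f xs - g xs)"
proof (rule recfn_comp2[OF _ assms(2,1)])
  have *: "rec_nat y (\<lambda>n r. r - 1) x = y - x" for x y :: nat by (induction x) auto
  show "recfn (Suc (Suc 0)) (\<lambda>xs. hd (tl xs) - hd xs)"
    using recfn_prim[of "Suc 0" hd "\<lambda>n r ys. r - 1"] recfn_pred[OF recfn_vars(2)]
    by (simp only: *) (simp add: recfn_vars)
qed

lemma recfn_triangle:
  assumes "recfn k f" shows "recfn k (\<lambda>xs. triangle (f xs))"
proof (rule recfn_comp1[OF _ assms])
  have *: "rec_nat 0 (\<lambda>n r. r + Suc n) x = triangle x" for x :: nat by (induction x) auto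
  have "recfn (Suc 0) (\<lambda>xs. rec_nat 0 (\<lambda>n r. r + Suc n) (hd xs))"
    using recfn_prim[of 0 "\<lambda>_. 0" "\<lambda>n r ys. r + Suc n"]
    by (simp add: recfn_vars recfn_const recfn_add recfn_Suc0)
  then show "recfn (Suc 0) (\<lambda>xs. triangle (hd xs))" by (simp only: *)
qed

lemma recfn_prod_encode:
  "recfn k f \<Longrightarrow> recfn k g \<Longrightarrow> recfn k (\<lambda>xs. prod_encode (f xs, g xs))"
  unfolding prod_encode_def by (simp add: recfn_add recfn_triangle)

section \<open>Recursive predicates: connectives and bounded quantifiers\<close>

lemma recpred_not: "recpred k P \<Longrightarrow> recpred k (\<lambda>xs. \<not> P xs)"
  unfolding recpred_def
  by (rule recfn_cong[OF recfn_diff[OF recfn_const[of k 1]]]) auto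

lemma recpred_conj:
  assumes "recpred k P" "recpred k Q" shows "recpred k (\<lambda>xs. P xs \<and> Q xs)"
  unfolding recpred_def
  by (rule recfn_cong[OF recfn_mult[OF assms[unfolded recpred_def]]]) auto

lemma recpred_imp: "recpred k P \<Longrightarrow> recpred k Q \<Longrightarrow> recpred k (\<lambda>xs. P xs \<longrightarrow> Q xs)"
  using recpred_not[OF recpred_conj[OF _ recpred_not], of k P Q] by simp

lemma recpred_disj:
  assumes "recpred k P" "recpred k Q" shows "recpred k (\<lambda>xs. P xs \<or> Q xs)"
  by (rule recpred_cong[OF recpred_imp[OF recpred_not[OF assms(1)] assms(2)]]) auto

lemma recpred_le:
  assumes "recfn k f" "recfn k g" shows "recpred k (\<lambda>xs. f xs \<le> g xs)"
  unfolding recpred_def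
  by (rule recfn_cong[OF recfn_diff[OF recfn_const[of k 1] recfn_diff[OF assms]]]) auto

lemma recpred_less: "recfn k f \<Longrightarrow> recfn k g \<Longrightarrow> recpred k (\<lambda>xs. f xs < g xs)"
  using recpred_not[OF recpred_le, of k g f] by (simp add: not_le)

lemma recpred_eq:
  assumes "recfn k f" "recfn k g" shows "recpred k (\<lambda>xs. f xs = g xs)"
  by (rule recpred_cong[OF recpred_conj[OF recpred_le[OF assms] recpred_le[OF assms(2,1)]]]) auto

lemma recfn_Least:
  assumes "recpred (Suc k) (\<lambda>xs. P (tl xs) (hd xs))"
    and "\<And>xs. length xs = k \<Longrightarrow> \<exists>y. P xs y"
  shows "recfn k (\<lambda>xs. LEAST y. P xs y)"
proof -
  have "recfn k (\<lambda>xs. LEAST y. (if \<not> P xs y then 1 else 0::nat) = 0)"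
    using assms recpred_not[OF assms(1)] by (intro recfn_mini) (auto simp: recpred_def)
  moreover have "((if \<not> P xs y then 1 else 0::nat) = 0) = P xs y" for xs y by simp
  ultimately show ?thesis by (simp only:)
qed

text \<open>The search for a witness also stops at \<open>b xs\<close>, which makes the minimization
  regular; a witness exists iff it stops earlier.\<close>

lemma recpred_ex:
  assumes "recpred (Suc k) (\<lambda>xs. P (tl xs) (hd xs))" and b: "recfn k b"
  shows "recpred k (\<lambda>xs. \<exists>y<b xs. P xs y)"
proof -
  have "recfn k (\<lambda>xs. LEAST y. P xs y \<or> b xs \<le> y)" (is "recfn k ?f")
    using assms by (intro recfn_Least recpred_disj recpred_le recfn_tl[OF b] recfn_hd) auto
  then have "recpred k (\<lambda>xs. ?f xs < b xs)" using b by (rule recpred_less)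
  then show ?thesis
  proof (rule recpred_cong)
    fix xs
    have "?f xs < b xs" if "P xs y" "y < b xs" for y
      using Least_le[of "\<lambda>y. P xs y \<or> b xs \<le> y" y] that by simp
    moreover have "P xs (?f xs) \<or> b xs \<le> ?f xs"
      by (rule LeastI[of "\<lambda>y. P xs y \<or> b xs \<le> y" "b xs"]) simp
    ultimately show "(\<exists>y<b xs. P xs y) = (?f xs < b xs)" by auto
  qed
qed

lemma recpred_all:
  assumes "recpred (Suc k) (\<lambda>xs. P (tl xs) (hd xs))" and b: "recfn k b"
  shows "recpred k (\<lambda>xs. \<forall>y<b xs. P xs y)"
  by (rule recpred_cong[OF recpred_not[OF recpred_ex[OF recpred_not[OF assms(1)] b]]]) auto

lemmas rec_intros = recfn_vars recfn_const recfn_Suc0 recfn_add recfn_mult recfn_power recfn_diff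
  recfn_prod_encode recpred_not recpred_conj recpred_imp recpred_disj recpred_le recpred_less
  recpred_eq recpred_ex recpred_all

text \<open>Parity of a quotient is expressed by sums, products and powers under bounded
  quantifiers, which are already known to be recursive.\<close>

lemma mem_set_decode_iff:
  "i \<in> set_decode w \<longleftrightarrow> (\<exists>q<Suc w. \<exists>r<2 ^ i. w = (2 * q + 1) * 2 ^ i + r)"
proof
  assume "i \<in> set_decode w"
  then have "odd (w div 2 ^ i)" by (simp add: set_decode_def)
  then obtain q where q: "w div 2 ^ i = 2 * q + 1" by (rule oddE)
  have "w = (2 * q + 1) * 2 ^ i + w mod 2 ^ i" using q by (metis div_mult_mod_eq)
  moreover have "q < Suc w" using q div_le_dividend[of w "2 ^ i"] by linarith
  ultimately show "\<exists>q<Suc w. \<exists>r<2 ^ i. w = (2 * q + 1) * 2 ^ i + r" by force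
next
  assume "\<exists>q<Suc w. \<exists>r<2 ^ i. w = (2 * q + 1) * 2 ^ i + r"
  then obtain q r where "r < 2 ^ i" "w = (2 * q + 1) * 2 ^ i + r" by blast
  then have "w div 2 ^ i = 2 * q + 1" by (simp del: mult_Suc)
  then show "i \<in> set_decode w" by (simp add: set_decode_def)
qed

lemma mem_set_decode_less:
  assumes "i \<in> set_decode w" shows "i < w"
proof -
  have "2 ^ i \<le> w"
    using assms unfolding set_decode_def by (metis div_less even_zero mem_Collect_eq not_less)
  then show ?thesis using less_exp[of i] by linarith
qed

lemma recpred_set_decode:
  assumes "recfn k f" "recfn k g" shows "recpred k (\<lambda>xs. f xs \<in> set_decode (g xs))"
proof (rule recpred_comp2[OF _ assms])
  show "recpred (Suc (Suc 0)) (\<lambda>xs. hd xs \<in> set_decode (hd (tl xs)))"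
    unfolding mem_set_decode_iff by (intro rec_intros)
qed

lemma recpred_ball_set_decode:
  assumes "recpred (Suc k) (\<lambda>xs. P (tl xs) (hd xs))" and b: "recfn k b"
  shows "recpred k (\<lambda>xs. \<forall>y\<in>set_decode (b xs). P xs y)"
proof -
  have "recpred k (\<lambda>xs. \<forall>y<b xs. y \<in> set_decode (b xs) \<longrightarrow> P xs y)"
    by (intro rec_intros recpred_set_decode assms recfn_tl[OF b])
  then show ?thesis by (rule recpred_cong) (auto dest: mem_set_decode_less)
qed

lemma recpred_bex_set_decode:
  assumes "recpred (Suc k) (\<lambda>xs. P (tl xs) (hd xs))" and b: "recfn k b"
  shows "recpred k (\<lambda>xs. \<exists>y\<in>set_decode (b xs). P xs y)"
  by (rule recpred_cong[OF recpred_not[OF recpred_ball_set_decode[OF recpred_not[OF assms(1)] b]]])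
     auto

section \<open>Codes of pairs and lists\<close>

lemma recfn_snd_decode:
  assumes "recfn k f" shows "recfn k (\<lambda>xs. snd (prod_decode (f xs)))"
proof (rule recfn_comp1[OF _ assms])
  have eq: "snd (prod_decode m) = (LEAST b. \<exists>a<Suc m. m = prod_encode (a, b))" for m
  proof -
    obtain a b where m: "m = prod_encode (a, b)" by (metis prod_decode_inverse surj_pair)
    then have "\<exists>a'<Suc m. m = prod_encode (a', b')" if "b' = b" for b'
      using that le_prod_encode_1[of a b] by (auto simp: less_Suc_eq_le)
    with m have "(\<exists>a<Suc m. m = prod_encode (a, b')) \<longleftrightarrow> b' = b" for b' by auto
    then show ?thesis by (auto simp: m Least_equality)
  qed
  have "\<exists>b. \<exists>a<Suc m. m = prod_encode (a, b)" for m
    by (metis le_prod_encode_1 less_Suc_eq_le prod_decode_inverse surj_pair)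
  then show "recfn (Suc 0) (\<lambda>xs. snd (prod_decode (hd xs)))"
    unfolding eq by (intro recfn_Least rec_intros)
qed

abbreviation codes_mem :: "nat \<Rightarrow> nat \<Rightarrow> bool" where
  "codes_mem x l \<equiv> x \<in> set (list_decode l)"

text \<open>A nonempty list is coded by the successor of a pair, so predecessor followed by second
  component yields the code of the tail. This also fixes the code \<open>0\<close> of the empty
  list, so the iteration may run past the end.\<close>

lemma list_encode_drop:
  "list_encode (drop k xs) = rec_nat (list_encode xs) (\<lambda>_ r. snd (prod_decode (r - 1))) k"
proof (induction k)
  case (Suc k)
  have *: "list_encode (tl ys) = snd (prod_decode (list_encode ys - 1))" for ys
  proof (cases ys)
    case Nil
    have "prod_decode 0 = (0, 0)"
      by (metis le_prod_encode_1 le_prod_encode_2 le_zero_eq prod_decode_inverse surj_pair)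
    then show ?thesis using Nil by simp
  qed simp
  show ?case using Suc *[of "drop k xs"] by (simp add: drop_Suc tl_drop)
qed simp

lemma length_le_list_encode: "length xs \<le> list_encode xs"
proof (induction xs)
  case (Cons x xs)
  then show ?case using le_prod_encode_2[of "list_encode xs" x] by simp
qed simp

lemma set_less_list_encode: "x \<in> set xs \<Longrightarrow> x < list_encode xs"
proof (induction xs)
  case (Cons y xs)
  then show ?case using le_prod_encode_2[of "list_encode xs" y] le_prod_encode_1[of y "list_encode xs"]
    by auto
qed simp

lemma codes_mem_less: "codes_mem x l \<Longrightarrow> x < l"
  using set_less_list_encode[of x "list_decode l"] by simp

lemma list_encode_drop_le: "list_encode (drop k xs) \<le> list_encode xs"
proof (induction xs arbitrary: k)
  case (Cons x xs)
  have "list_encode xs \<le> list_encode (x # xs)"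
    using le_prod_encode_2[of "list_encode xs" x] by simp
  with Cons show ?case by (cases k) (auto intro: order_trans simp del: list_encode.simps)
qed simp

text \<open>Membership means that some iterated tail starts with \<open>x\<close>. Both bounds are
  \<open>l\<close> because neither the length of a list nor the code of a tail exceeds the code of
  the list.\<close>

lemma codes_mem_iff:
  "codes_mem x l \<longleftrightarrow> (\<exists>k<l. \<exists>z<l.
     rec_nat l (\<lambda>_ r. snd (prod_decode (r - 1))) k = Suc (prod_encode (x, z)))"
proof
  assume "codes_mem x l"
  then obtain k where k: "k < length (list_decode l)" "list_decode l ! k = x"
    by (metis in_set_conv_nth)
  let ?z = "list_encode (drop (Suc k) (list_decode l))"
  have "drop k (list_decode l) = x # drop (Suc k) (list_decode l)"
    using k Cons_nth_drop_Suc by metis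
  then have *: "list_encode (drop k (list_decode l)) = Suc (prod_encode (x, ?z))" by simp
  moreover have "?z < l"
    using * list_encode_drop_le[of k "list_decode l"] le_prod_encode_2[of ?z x] by simp
  moreover have "k < l" using k length_le_list_encode[of "list_decode l"] by simp
  ultimately show "\<exists>k<l. \<exists>z<l.
     rec_nat l (\<lambda>_ r. snd (prod_decode (r - 1))) k = Suc (prod_encode (x, z))"
    using list_encode_drop[of k "list_decode l"] by auto
next
  assume "\<exists>k<l. \<exists>z<l. rec_nat l (\<lambda>_ r. snd (prod_decode (r - 1))) k = Suc (prod_encode (x, z))"
  then obtain k z where "list_encode (drop k (list_decode l)) = Suc (prod_encode (x, z))"
    using list_encode_drop[of _ "list_decode l"] by auto
  also have "\<dots> = list_encode (x # list_decode z)" by simp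
  finally have "drop k (list_decode l) = x # list_decode z"
    by (simp only: list_encode_eq)
  then show "codes_mem x l" by (metis in_set_dropD list.set_intros(1))
qed

lemma recpred_codes_mem:
  assumes "recfn k f" "recfn k g" shows "recpred k (\<lambda>xs. codes_mem (f xs) (g xs))"
proof (rule recpred_comp2[OF _ assms])
  have "recfn (Suc (Suc 0)) (\<lambda>xs. rec_nat (hd (tl xs)) (\<lambda>_ r. snd (prod_decode (r - 1))) (hd xs))"
    using recfn_prim[of "Suc 0" hd "\<lambda>_ r _. snd (prod_decode (r - 1))"]
    by (simp add: recfn_vars recfn_snd_decode recfn_pred del: One_nat_def)
  note * = recfn_comp2[OF this]
  show "recpred (Suc (Suc 0)) (\<lambda>xs. codes_mem (hd xs) (hd (tl xs)))"
    unfolding codes_mem_iff by (intro rec_intros *)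
qed


section \<open>Quasi-models\<close>

abbreviation pe :: "nat \<Rightarrow> nat \<Rightarrow> nat" where "pe a b \<equiv> prod_encode (a, b)"

text \<open>
  A world is a number \<open>w\<close> whose binary digits form the set of its items, and a quasi-model is a
  number \<open>W\<close> whose digits form the set of its worlds. The items \<open>itT w a\<close> and \<open>itF w a\<close> put the
  formula coded by \<open>a\<close> on the left and on the right at \<open>w\<close>, \<open>itN w a\<close> says that it holds at every
  successor of \<open>w\<close>, \<open>itE w t a\<close> that \<open>t\<close> is evidence for it, \<open>itM w l\<close> that \<open>w\<close> interprets the
  label \<open>l\<close>, and \<open>itS w l\<close> that the interpretation of \<open>l\<close> sees \<open>w\<close>. Items \<open>pe 0 _\<close> persist along
  accessibility, so that accessibility need not be part of a quasi-model. The items \<open>itS\<close> keep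
  filtration from relating labels that are unrelated in the given branch.
\<close>

abbreviation itT :: "nat \<Rightarrow> nat \<Rightarrow> bool" where "itT w a \<equiv> pe 4 a \<in> set_decode w"
abbreviation itF :: "nat \<Rightarrow> nat \<Rightarrow> bool" where "itF w a \<equiv> pe 2 a \<in> set_decode w"
abbreviation itM :: "nat \<Rightarrow> nat \<Rightarrow> bool" where "itM w l \<equiv> pe 3 l \<in> set_decode w"
abbreviation itN :: "nat \<Rightarrow> nat \<Rightarrow> bool" where "itN w a \<equiv> pe 0 (pe 0 a) \<in> set_decode w"
abbreviation itE :: "nat \<Rightarrow> nat \<Rightarrow> nat \<Rightarrow> bool" where
  "itE w t a \<equiv> pe 0 (pe 3 (pe t a)) \<in> set_decode w"
abbreviation itS :: "nat \<Rightarrow> nat \<Rightarrow> bool" where "itS w l \<equiv> pe 0 (pe 2 l) \<in> set_decode w"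

text \<open>The bound on \<open>j\<close> only keeps the relation visibly recursive: members of
  \<open>set_decode w\<close> are below \<open>w\<close>, and \<open>j \<le> pe 0 j\<close>.\<close>

definition acc :: "nat \<Rightarrow> nat \<Rightarrow> bool" where
  "acc w v \<longleftrightarrow> (\<forall>j<w. pe 0 j \<in> set_decode w \<longrightarrow> pe 0 j \<in> set_decode v)"

text \<open>Hintikka conditions on codes; the inner tags are those of
  \<open>fm_code\<close>.\<close>

definition prop_ok :: "nat \<Rightarrow> nat \<Rightarrow> bool" where
  "prop_ok n w \<longleftrightarrow>
    (\<forall>a<n. \<not> (itT w (pe 0 a) \<and> itF w (pe 0 a))) \<and>
    \<not> itT w (pe 1 0) \<and>
    (\<forall>a<n. (itT w (pe 2 a) \<longrightarrow> itF w a) \<and> (itF w (pe 2 a) \<longrightarrow> itT w a)) \<and>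
    (\<forall>a<n. \<forall>b<n.
      (itT w (pe 3 (pe a b)) \<longrightarrow> itT w a \<and> itT w b) \<and>
      (itF w (pe 3 (pe a b)) \<longrightarrow> itF w a \<or> itF w b) \<and>
      (itT w (pe 4 (pe a b)) \<longrightarrow> itT w a \<or> itT w b) \<and>
      (itF w (pe 4 (pe a b)) \<longrightarrow> itF w a \<and> itF w b) \<and>
      (itT w (pe 5 (pe a b)) \<longrightarrow> itF w a \<or> itT w b) \<and>
      (itF w (pe 5 (pe a b)) \<longrightarrow> itT w a \<and> itF w b))"

text \<open>Closure under the operations on terms, demanded only as long as the resulting codes stay
  below \<open>n\<close>, since a finite world cannot be closed outright.\<close>

definition ev_ok :: "nat \<Rightarrow> nat \<Rightarrow> bool" where
  "ev_ok n w \<longleftrightarrow>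
    (\<forall>s<n. \<forall>t<n. \<forall>a<n.
      (itE w s a \<and> pe 3 (pe s t) < n \<longrightarrow> itE w (pe 3 (pe s t)) a) \<and>
      (itE w t a \<and> pe 3 (pe s t) < n \<longrightarrow> itE w (pe 3 (pe s t)) a)) \<and>
    (\<forall>s<n. \<forall>t<n. \<forall>a<n. \<forall>b<n.
      itE w s (pe 5 (pe a b)) \<and> itE w t a \<and> pe 2 (pe s t) < n \<longrightarrow> itE w (pe 2 (pe s t)) b) \<and>
    (\<forall>t<n. \<forall>a<n.
      itE w t a \<and> pe 4 t < n \<and> pe 6 (pe t a) < n \<longrightarrow> itE w (pe 4 t) (pe 6 (pe t a)))"

text \<open>The last two clauses pin down accessibility from a world naming \<open>l\<close>: since
  \<open>itS\<close> persists, its successors in \<open>W\<close> are exactly the worlds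
  \<open>v\<close> with \<open>itS v l\<close>.\<close>

definition modal_ok :: "nat \<Rightarrow> nat \<Rightarrow> nat \<Rightarrow> bool" where
  "modal_ok n W w \<longleftrightarrow>
    (\<forall>a<n. itN w a \<longrightarrow> itT w a) \<and>
    (\<forall>a<n. itT w (pe 7 a) \<longrightarrow> itN w a) \<and>
    (\<forall>t<n. \<forall>a<n. itT w (pe 6 (pe t a)) \<longrightarrow> itN w a \<and> itE w t a) \<and>
    (\<forall>a<n. itF w (pe 7 a) \<longrightarrow> (\<exists>v\<in>set_decode W. acc w v \<and> itF v a)) \<and>
    (\<forall>t<n. \<forall>a<n. itF w (pe 6 (pe t a)) \<and> itE w t a \<longrightarrow>
      (\<exists>v\<in>set_decode W. acc w v \<and> itF v a)) \<and>
    (\<forall>l<n. itM w l \<longrightarrow> itS w l) \<and>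
    (\<forall>l<n. itM w l \<longrightarrow> (\<forall>v\<in>set_decode W. itS v l \<longrightarrow> acc w v))"

text \<open>The number \<open>pe 6 (pe (pe 1 q) a)\<close> codes a formula
  \<open>Just (JConst q) A\<close>; the outer tags 0, 1, 2 of members of \<open>g\<close> and
  \<open>d\<close> are those of \<open>lfm_code\<close>. An atom \<open>Rel k l\<close> is checked
  at the worlds naming its second label \<open>l\<close>.\<close>

definition input_ok :: "nat \<Rightarrow> nat \<Rightarrow> nat \<Rightarrow> nat \<Rightarrow> nat \<Rightarrow> bool" where
  "input_ok n c g d w \<longleftrightarrow>
    (\<forall>q<n. \<forall>a<n. codes_mem (pe 6 (pe (pe 1 q) a)) c \<longrightarrow> itE w (pe 1 q) a) \<and>
    (\<forall>l<n. itM w l \<longrightarrow>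
      (\<forall>a<n. (codes_mem (pe 0 (pe l a)) g \<longrightarrow> itT w a) \<and>
             (codes_mem (pe 0 (pe l a)) d \<longrightarrow> itF w a)) \<and>
      (\<forall>k<n. (codes_mem (pe 1 (pe k l)) g \<longrightarrow> itS w k) \<and>
             (codes_mem (pe 1 (pe k l)) d \<longrightarrow> \<not> itS w k)) \<and>
      (\<forall>t<n. \<forall>a<n. (codes_mem (pe 2 (pe l (pe t a))) g \<longrightarrow> itE w t a) \<and>
             (codes_mem (pe 2 (pe l (pe t a))) d \<longrightarrow> \<not> itE w t a)))"

definition quasi_model :: "nat \<Rightarrow> nat \<Rightarrow> nat \<Rightarrow> nat \<Rightarrow> nat \<Rightarrow> bool" where
  "quasi_model n c g d W \<longleftrightarrow>
    (\<forall>l<n. \<exists>w\<in>set_decode W. itM w l) \<and>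
    (\<forall>w\<in>set_decode W. prop_ok n w \<and> ev_ok n w \<and> modal_ok n W w \<and> input_ok n c g d w)"

text \<open>The most deeply nested items carry evidence, with shape
  \<open>pe 0 (pe 3 (pe t a))\<close>. The numbers 4 and 3 are the largest outer and inner tags, and
  pairing is monotone.\<close>

definition item_bound :: "nat \<Rightarrow> nat" where
  "item_bound n = Suc (pe 4 (pe 3 (pe n n)))"

text \<open>The nested pairs spell out \<open>list_encode [c, g, d]\<close>. The double exponential
  arises because \<open>W\<close> codes a set of worlds, each coding a set of items below
  \<open>item_bound n\<close>.\<close>

definition refutable :: "nat \<Rightarrow> bool" where
  "refutable n \<longleftrightarrow> (\<exists>c<n. \<exists>g<n. \<exists>d<n. n = Suc (pe c (Suc (pe g (Suc (pe d 0))))) \<and>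
    (\<exists>W < 2 ^ (2 ^ item_bound n). quasi_model n c g d W))"

lemmas quasi_model_intros = rec_intros recpred_set_decode recpred_ball_set_decode recpred_bex_set_decode
  recpred_codes_mem

text \<open>Composition reduces to two plain variables before unfolding, so \<open>f\<close> and
  \<open>g\<close> need not be lifted under the quantifiers of the definition.\<close>

lemma recpred_acc: "recfn k f \<Longrightarrow> recfn k g \<Longrightarrow> recpred k (\<lambda>xs. acc (f xs) (g xs))"
  by (rule recpred_comp2) (unfold acc_def, intro quasi_model_intros)

lemma recpred_prop_ok: "recfn k f \<Longrightarrow> recfn k g \<Longrightarrow> recpred k (\<lambda>xs. prop_ok (f xs) (g xs))"
  by (rule recpred_comp2) (unfold prop_ok_def, intro quasi_model_intros)

lemma recpred_ev_ok: "recfn k f \<Longrightarrow> recfn k g \<Longrightarrow> recpred k (\<lambda>xs. ev_ok (f xs) (g xs))"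
  by (rule recpred_comp2) (unfold ev_ok_def, intro quasi_model_intros)

lemma recpred_refutable: "recpred (Suc 0) (\<lambda>xs. refutable (hd xs))"
  unfolding refutable_def quasi_model_def modal_ok_def input_ok_def item_bound_def
  by (intro quasi_model_intros recpred_acc recpred_prop_ok recpred_ev_ok)

lemma decidable_if_not_refutable:
  assumes "\<And>n x. x \<in> D \<Longrightarrow> codes n x \<Longrightarrow> P x \<longleftrightarrow> \<not> refutable n"
  shows "decidable codes D P"
proof -
  obtain f where "recursive 1 f"
    and f: "\<And>xs. length xs = 1 \<Longrightarrow> (if \<not> refutable (hd xs) then 1 else 0) = f xs"
    using recpred_not[OF recpred_refutable] unfolding recpred_def recfn_def by auto
  moreover have "f [n] = (if P x then 1 else 0)" if "x \<in> D" "codes n x" for n x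
    using assms[OF that] f[of "[n]"] by simp
  ultimately show ?thesis unfolding decidable_def by blast
qed


section \<open>Soundness\<close>

text \<open>Fitting-style models with worlds \<open>W\<close>. Evidence for constants is required on
  \<open>W\<close> only: in the intended instance it comes from \<open>input_ok\<close>, which
  constrains members of \<open>W\<close> alone.\<close>

locale kripke_model =
  fixes CS :: "fm set" and W :: "'w set" and R :: "'w \<Rightarrow> 'w \<Rightarrow> bool"
    and \<E> :: "'w \<Rightarrow> tm \<Rightarrow> fm \<Rightarrow> bool" and V :: "'w \<Rightarrow> nat \<Rightarrow> bool"
  assumes R_refl: "R w w"
    and R_trans: "R w v \<Longrightarrow> R v u \<Longrightarrow> R w u"
    and ev_mono: "R w v \<Longrightarrow> \<E> w t A \<Longrightarrow> \<E> v t A"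
    and ev_plus1: "\<E> w s A \<Longrightarrow> \<E> w (Plus s t) A"
    and ev_plus2: "\<E> w t A \<Longrightarrow> \<E> w (Plus s t) A"
    and ev_app: "\<E> w s (Imp A B) \<Longrightarrow> \<E> w t A \<Longrightarrow> \<E> w (App s t) B"
    and ev_bang: "\<E> w t A \<Longrightarrow> \<E> w (Bang t) (Just t A)"
    and ev_const: "w \<in> W \<Longrightarrow> Just (JConst c) A \<in> CS \<Longrightarrow> \<E> w (JConst c) A"
begin

fun forces :: "'w \<Rightarrow> fm \<Rightarrow> bool" where
  "forces w (PVar p) = V w p"
| "forces w Bot = False"
| "forces w (Neg A) = (\<not> forces w A)"
| "forces w (Conj A B) = (forces w A \<and> forces w B)"
| "forces w (Disj A B) = (forces w A \<or> forces w B)"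
| "forces w (Imp A B) = (forces w A \<longrightarrow> forces w B)"
| "forces w (Just t A) = (\<E> w t A \<and> (\<forall>v\<in>W. R w v \<longrightarrow> forces v A))"
| "forces w (Box A) = (\<forall>v\<in>W. R w v \<longrightarrow> forces v A)"

fun sat :: "(label \<Rightarrow> 'w) \<Rightarrow> lfm \<Rightarrow> bool" where
  "sat \<rho> (Forces w A) = forces (\<rho> w) A"
| "sat \<rho> (Rel w v) = R (\<rho> w) (\<rho> v)"
| "sat \<rho> (Ev w t A) = \<E> (\<rho> w) t A"

lemma sat_upd: "v \<notin> labels X \<Longrightarrow> sat (\<rho>(v := u)) X = sat \<rho> X"
  by (cases X) auto

lemma sat_upd_fresh:
  assumes "fresh v \<Gamma> \<Delta>" "X \<in># \<Gamma> \<or> X \<in># \<Delta>" shows "sat (\<rho>(v := u)) X = sat \<rho> X"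
  using assms sat_upd unfolding fresh_def by (metis union_iff)

theorem soundness:
  assumes "G3S4LP CS \<Gamma> \<Delta>" and "range \<rho> \<subseteq> W" and "\<forall>X\<in>#\<Gamma>. sat \<rho> X"
  shows "\<exists>X\<in>#\<Delta>. sat \<rho> X"
  using assms
proof (induction arbitrary: \<rho> rule: G3S4LP.induct)
  case (RBox w v \<Gamma> A \<Delta>)
  show ?case
  proof (rule ccontr)
    assume neg: "\<not> ?case"
    \<comment> \<open>The eigenvariable is reinterpreted as a successor refuting \<open>A\<close>;
      by freshness this changes the truth of nothing in the conclusion.\<close>
    then obtain u where u: "u \<in> W" "R (\<rho> w) u" "\<not> forces u A" by auto
    have "\<exists>X\<in>#add_mset (Forces v A) \<Delta>. sat (\<rho>(v := u)) X"
    proof (rule RBox.IH)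
      show "range (\<rho>(v := u)) \<subseteq> W" using RBox.prems u by (auto simp: image_subset_iff)
      have "v \<noteq> w" using RBox.hyps by (auto simp: fresh_def)
      then show "\<forall>X\<in>#add_mset (Rel w v) \<Gamma>. sat (\<rho>(v := u)) X"
        using RBox.prems u sat_upd_fresh[OF RBox.hyps(2)] by auto
    qed
    then show False using neg u sat_upd_fresh[OF RBox.hyps(2)] by auto
  qed
next
  case (RJust w v t A \<Gamma> \<Delta>)
  show ?case
  proof (rule ccontr)
    assume neg: "\<not> ?case"
    then obtain u where u: "u \<in> W" "R (\<rho> w) u" "\<not> forces u A" using RJust.prems by auto
    have "\<exists>X\<in>#add_mset (Forces v A) \<Delta>. sat (\<rho>(v := u)) X"
    proof (rule RJust.IH)
      show "range (\<rho>(v := u)) \<subseteq> W" using RJust.prems u by (auto simp: image_subset_iff)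
      have "v \<noteq> w" using RJust.hyps by (auto simp: fresh_def)
      then show "\<forall>X\<in>#add_mset (Rel w v) (add_mset (Ev w t A) \<Gamma>). sat (\<rho>(v := u)) X"
        using RJust.prems u sat_upd_fresh[OF RJust.hyps(2)] by auto
    qed
    then show False using neg u sat_upd_fresh[OF RJust.hyps(2)] by auto
  qed
next
  case (LBox v A w \<Gamma> \<Delta>)
  then have "\<rho> v \<in> W" by auto
  with LBox show ?case by simp
next
  case (LJust v A w t \<Gamma> \<Delta>)
  then have "\<rho> v \<in> W" by auto
  with LJust show ?case by simp
next
  case (AN w c A \<Gamma> \<Delta>)
  then have "\<E> (\<rho> w) (JConst c) A" by (intro ev_const) auto
  with AN show ?case by simp
next
  case (EApp w s t B A \<Gamma> \<Delta>)
  then show ?case by (auto intro: ev_app)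
next
  case (LImp \<Gamma> w A \<Delta> B)
  then show ?case by (cases "forces (\<rho> w) A") auto
next
  case (RImp w A \<Gamma> B \<Delta>)
  then show ?case by (cases "forces (\<rho> w) A") auto
next
  case (RNeg w A \<Gamma> \<Delta>)
  then show ?case by (cases "forces (\<rho> w) A") auto
next
  case (Trans w u v \<Gamma> \<Delta>)
  have "R (\<rho> w) (\<rho> u)" using Trans.prems(2) by (auto intro: R_trans)
  then show ?case using Trans by simp
next
  case (RConj \<Gamma> w A \<Delta> B)
  then show ?case using RConj.IH(1)[of \<rho>] RConj.IH(2)[of \<rho>] by auto
next
  case (LDisj w A \<Gamma> \<Delta> B)
  then show ?case using LDisj.IH(1)[of \<rho>] LDisj.IH(2)[of \<rho>] by auto
next
  case (Mon v t A w \<Gamma> \<Delta>)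
  then show ?case by (auto intro: ev_mono)
qed (auto intro: R_refl ev_plus1 ev_plus2 ev_bang)

end

section \<open>The Kripke model of a quasi-model\<close>

lemma acc_iff: "acc w v \<longleftrightarrow> (\<forall>j. pe 0 j \<in> set_decode w \<longrightarrow> pe 0 j \<in> set_decode v)"
  unfolding acc_def using mem_set_decode_less le_prod_encode_2 by (metis le_less_trans)

text \<open>Strictness fails for tag 0, as \<open>pe 0 0 = 0\<close>; in \<open>tm_code\<close> and
  \<open>fm_code\<close> that tag belongs to variables, so all proper subterms and subformulas get
  smaller codes.\<close>

lemma pe_less:
  assumes "0 < k" shows "x < pe k x"
proof -
  have "x < triangle (k + x) + k"
    using assms by (induction x) (auto simp: algebra_simps)
  then show ?thesis by (simp add: prod_encode_def)
qed

lemma pe2_less: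
  assumes "0 < k" shows "a < pe k (pe a b) \<and> b < pe k (pe a b)"
  using pe_less[OF assms, of "pe a b"] le_prod_encode_1[of a b] le_prod_encode_2[of b a]
  by linarith

text \<open>The least evidence relation containing the recorded items; its closure rules ignore the
  bound \<open>n\<close>, as a model must interpret all terms.\<close>

inductive evid :: "nat \<Rightarrow> nat \<Rightarrow> tm \<Rightarrow> fm \<Rightarrow> bool" for n w where
  base: "itE w (tm_code t) (fm_code A) \<Longrightarrow> fm_code A < n \<Longrightarrow> evid n w t A"
| plus1: "evid n w s A \<Longrightarrow> evid n w (Plus s t) A"
| plus2: "evid n w t A \<Longrightarrow> evid n w (Plus s t) A"
| app: "evid n w s (Imp A B) \<Longrightarrow> evid n w t A \<Longrightarrow> evid n w (App s t) B"
| bang: "evid n w t A \<Longrightarrow> evid n w (Bang t) (Just t A)"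

lemma evid_mono: "evid n w t A \<Longrightarrow> acc w v \<Longrightarrow> evid n v t A"
  by (induction rule: evid.induct) (auto intro: evid.intros simp: acc_iff)

lemmas quasi_modelD =
  quasi_model_def[THEN iffD1, THEN conjunct1, rule_format]
  quasi_model_def[THEN iffD1, THEN conjunct2, rule_format]

lemmas prop_okD =
  prop_ok_def[THEN iffD1, THEN conjunct1, rule_format]
  prop_ok_def[THEN iffD1, THEN conjunct2, THEN conjunct1, rule_format]
  prop_ok_def[THEN iffD1, THEN conjunct2, THEN conjunct2, THEN conjunct1, rule_format]
  prop_ok_def[THEN iffD1, THEN conjunct2, THEN conjunct2, THEN conjunct2, rule_format]

lemmas ev_okD =
  ev_ok_def[THEN iffD1, THEN conjunct1, rule_format]
  ev_ok_def[THEN iffD1, THEN conjunct2, THEN conjunct1, rule_format]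
  ev_ok_def[THEN iffD1, THEN conjunct2, THEN conjunct2, rule_format]

lemmas modal_okD =
  modal_ok_def[THEN iffD1, THEN conjunct1, rule_format]
  modal_ok_def[THEN iffD1, THEN conjunct2, THEN conjunct1, rule_format]
  modal_ok_def[THEN iffD1, THEN conjunct2, THEN conjunct2, THEN conjunct1, rule_format]
  modal_ok_def[THEN iffD1, THEN conjunct2, THEN conjunct2, THEN conjunct2, THEN conjunct1, rule_format]
  modal_ok_def[THEN iffD1, THEN conjunct2, THEN conjunct2, THEN conjunct2, THEN conjunct2, THEN conjunct1, rule_format]
  modal_ok_def[THEN iffD1, THEN conjunct2, THEN conjunct2, THEN conjunct2, THEN conjunct2, THEN conjunct2, THEN conjunct1, rule_format]
  modal_ok_def[THEN iffD1, THEN conjunct2, THEN conjunct2, THEN conjunct2, THEN conjunct2, THEN conjunct2, THEN conjunct2, rule_format]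

lemmas input_okD =
  input_ok_def[THEN iffD1, THEN conjunct1, rule_format]
  input_ok_def[THEN iffD1, THEN conjunct2, rule_format]

text \<open>
  Only formulas \<open>t : A\<close> can leave the range of codes below \<open>n\<close> without leaving it on the term
  side, and such formulas are useless as the major premise of an application.
\<close>

lemma evid_conservative:
  assumes "ev_ok n w" and "evid n w t A" and "tm_code t < n"
  shows "itE w (tm_code t) (fm_code A) \<and> fm_code A < n \<or> n \<le> fm_code A \<and> (\<exists>s B. A = Just s B)"
  using assms(2,3)
proof (induction rule: evid.induct)
  case (base t A)
  then show ?case by simp
next
  case (plus1 s A t)
  then have "tm_code s < n" "tm_code t < n"
    using pe2_less[of 3 "tm_code s" "tm_code t"] by auto
  then show ?case using plus1 ev_okD(1)[OF assms(1), of "tm_code s" "tm_code t" "fm_code A"] by auto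
next
  case (plus2 t A s)
  then have "tm_code s < n" "tm_code t < n"
    using pe2_less[of 3 "tm_code s" "tm_code t"] by auto
  then show ?case using plus2 ev_okD(1)[OF assms(1), of "tm_code s" "tm_code t" "fm_code A"] by auto
next
  case (app s A B t)
  then have st: "tm_code s < n" "tm_code t < n"
    using pe2_less[of 2 "tm_code s" "tm_code t"] by auto
  with app have s: "itE w (tm_code s) (fm_code (Imp A B))" "fm_code (Imp A B) < n" by auto
  then have "fm_code A < n" "fm_code B < n"
    using pe2_less[of 5 "fm_code A" "fm_code B"] by auto
  \<comment> \<open>\<open>A\<close> is part of an implication with code below \<open>n\<close>,
    which excludes the second alternative of the induction hypothesis for \<open>t\<close>.\<close>
  moreover from this have "itE w (tm_code t) (fm_code A)" using app st by auto
  ultimately show ?case using s st app.prems ev_okD(2)[OF assms(1), of "tm_code s" "tm_code t" "fm_code A" "fm_code B"] by simp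
next
  case (bang t A)
  then have t: "tm_code t < n" using pe_less[of 4 "tm_code t"] by auto
  show ?case
  proof (cases "fm_code (Just t A) < n")
    case True
    then have A: "fm_code A < n" using pe2_less[of 6 "tm_code t" "fm_code A"] by auto
    with bang t have "itE w (tm_code t) (fm_code A)" by auto
    with t A True bang.prems ev_okD(3)[OF assms(1), of "tm_code t" "fm_code A"] show ?thesis by simp
  qed auto
qed

lemma subformula_code_less:
  "fm_code (Neg A) < n \<Longrightarrow> fm_code A < n"
  "fm_code (Conj A B) < n \<Longrightarrow> fm_code A < n \<and> fm_code B < n"
  "fm_code (Disj A B) < n \<Longrightarrow> fm_code A < n \<and> fm_code B < n"
  "fm_code (Imp A B) < n \<Longrightarrow> fm_code A < n \<and> fm_code B < n"
  "fm_code (Just t A) < n \<Longrightarrow> tm_code t < n \<and> fm_code A < n"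
  "fm_code (Box A) < n \<Longrightarrow> fm_code A < n"
  using pe_less[of 2 "fm_code A"] pe_less[of 7 "fm_code A"]
    pe2_less[of 3 "fm_code A" "fm_code B"] pe2_less[of 4 "fm_code A" "fm_code B"]
    pe2_less[of 5 "fm_code A" "fm_code B"] pe2_less[of 6 "tm_code t" "fm_code A"]
  by auto

lemma quasi_model_kripke:
  assumes "quasi_model n c g d W" and "\<And>x. codes_mem x c \<Longrightarrow> x < n"
  shows "kripke_model {A. codes_mem (fm_code A) c} (set_decode W) acc (evid n)"
proof
  fix w k A assume "w \<in> set_decode W" and "Just (JConst k) A \<in> {A. codes_mem (fm_code A) c}"
  moreover from this have "fm_code (Just (JConst k) A) < n" using assms(2) by simp
  moreover from this have "tm_code (JConst k) < n" "fm_code A < n"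
    using subformula_code_less(5) by blast+
  moreover from this have "k < n" using pe_less[of 1 k] by simp
  moreover have "input_ok n c g d w"
    using calculation(1) quasi_modelD(2)[OF assms(1)] by blast
  ultimately show "evid n w (JConst k) A"
    using input_okD(1)[of n c g d w k "fm_code A"] by (intro evid.base) simp_all
qed (auto simp: acc_iff intro: evid.intros evid_mono)

lemma truth_lemma:
  assumes qm: "quasi_model n c g d W" and c: "\<And>x. codes_mem x c \<Longrightarrow> x < n"
    and "w \<in> set_decode W" and "fm_code A < n"
  defines "frc \<equiv> kripke_model.forces (set_decode W) acc (evid n) (\<lambda>w p. itT w (pe 0 p))"
  shows "(itT w (fm_code A) \<longrightarrow> frc w A) \<and> (itF w (fm_code A) \<longrightarrow> \<not> frc w A)"
proof -
  interpret kripke_model "{A. codes_mem (fm_code A) c}" "set_decode W" acc "evid n"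
      "\<lambda>w p. itT w (pe 0 p)"
    by (rule quasi_model_kripke[OF qm]) (rule c)
  have ok: "prop_ok n w" "ev_ok n w" "modal_ok n W w" if "w \<in> set_decode W" for w
    using that qm quasi_modelD(2) by blast+
  show ?thesis
    using assms(3,4)
  proof (induction A arbitrary: w)
    case (PVar p)
    then have "p < n" by (metis fm_code.simps(1) le_less_trans le_prod_encode_2)
    then show ?case using prop_okD(1)[OF ok(1)[OF PVar(1)], of p] by (auto simp: frc_def)
  next
    case Bot
    then show ?case using prop_okD(2)[OF ok(1)[OF Bot(1)]]
      by (auto simp: frc_def)
  next
    case (Neg A)
    have A: "fm_code A < n" using subformula_code_less(1)[OF Neg(3)] .
    show ?case using prop_okD(3)[OF ok(1)[OF Neg(2)] A] Neg.IH[OF Neg(2) A]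
      by (auto simp: frc_def)
  next
    case (Conj A B)
    then have AB: "fm_code A < n" "fm_code B < n" using subformula_code_less(2) by blast+
    show ?case
      using prop_okD(4)[OF ok(1)[OF Conj(3)] AB] Conj.IH(1)[OF Conj(3) AB(1)]
        Conj.IH(2)[OF Conj(3) AB(2)]
      by (auto simp: frc_def)
  next
    case (Disj A B)
    then have AB: "fm_code A < n" "fm_code B < n" using subformula_code_less(3) by blast+
    show ?case
      using prop_okD(4)[OF ok(1)[OF Disj(3)] AB] Disj.IH(1)[OF Disj(3) AB(1)]
        Disj.IH(2)[OF Disj(3) AB(2)]
      by (auto simp: frc_def)
  next
    case (Imp A B)
    then have AB: "fm_code A < n" "fm_code B < n" using subformula_code_less(4) by blast+
    show ?case
      using prop_okD(4)[OF ok(1)[OF Imp(3)] AB] Imp.IH(1)[OF Imp(3) AB(1)]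
        Imp.IH(2)[OF Imp(3) AB(2)]
      by (auto simp: frc_def)
  next
    case (Just t A)
    note lt = subformula_code_less(5)[OF Just(3)]
    have T: "frc v A" if "itT w (fm_code (Just t A))" "v \<in> set_decode W" "acc w v" for v
    proof -
      \<comment> \<open>Truth of \<open>A\<close> is carried to successors by \<open>itN\<close>,
        which persists; items \<open>itT\<close> need not.\<close>
      have "itN w (fm_code A)" using that(1) modal_okD(3)[OF ok(3)[OF Just(2)], of "tm_code t" "fm_code A"] lt by simp
      then have "itN v (fm_code A)" using that(3) by (simp add: acc_iff)
      then have "itT v (fm_code A)" using modal_okD(1)[OF ok(3)[OF that(2)]] lt by simp
      then show ?thesis using Just.IH that(2) lt by blast
    qed
    have "evid n w t A" if "itT w (fm_code (Just t A))"
      using that modal_okD(3)[OF ok(3)[OF Just(2)], of "tm_code t" "fm_code A"] lt by (simp add: evid.base)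
    moreover have "\<exists>v\<in>set_decode W. acc w v \<and> \<not> frc v A"
      if F: "itF w (fm_code (Just t A))" "evid n w t A"
    proof -
      \<comment> \<open>Evidence obtained by closure was already recorded, so
        \<open>modal_ok\<close> yields a successor refuting \<open>A\<close>.\<close>
      have "itE w (tm_code t) (fm_code A)"
        using evid_conservative[OF ok(2)[OF Just(2)] F(2)] lt by auto
      then obtain v where "v \<in> set_decode W" "acc w v" "itF v (fm_code A)"
        using F(1) modal_okD(5)[OF ok(3)[OF Just(2)], of "tm_code t" "fm_code A"] lt by auto
      then show ?thesis using Just.IH lt by blast
    qed
    moreover have "frc w (Just t A) \<longleftrightarrow> evid n w t A \<and> (\<forall>v\<in>set_decode W. acc w v \<longrightarrow> frc v A)"
      by (simp add: frc_def)
    ultimately show ?case using T by blast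
  next
    case (Box A)
    note lt = subformula_code_less(6)[OF Box(3)]
    have T: "frc v A" if "itT w (fm_code (Box A))" "v \<in> set_decode W" "acc w v" for v
    proof -
      have "itN w (fm_code A)" using that(1) modal_okD(2)[OF ok(3)[OF Box(2)]] lt by simp
      then have "itN v (fm_code A)" using that(3) by (simp add: acc_iff)
      then have "itT v (fm_code A)" using modal_okD(1)[OF ok(3)[OF that(2)]] lt by simp
      then show ?thesis using Box.IH that(2) lt by blast
    qed
    moreover have "\<exists>v\<in>set_decode W. acc w v \<and> \<not> frc v A" if F: "itF w (fm_code (Box A))"
    proof -
      obtain v where "v \<in> set_decode W" "acc w v" "itF v (fm_code A)"
        using F modal_okD(4)[OF ok(3)[OF Box(2)]] lt by auto
      then show ?thesis using Box.IH lt by blast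
    qed
    moreover have "frc w (Box A) \<longleftrightarrow> (\<forall>v\<in>set_decode W. acc w v \<longrightarrow> frc v A)"
      by (simp add: frc_def)
    ultimately show ?case by blast
  qed
qed

lemma codes_mem_list_encode_map:
  assumes "inj f" shows "codes_mem (f x) (list_encode (map f xs)) \<longleftrightarrow> x \<in> set xs"
  using assms by (auto dest: injD)

lemma inj_codes: "inj fm_code" "inj lfm_code"
  by (auto intro: injI fm_code_inject lfm_code_inject)

lemma quasi_model_not_derivable:
  assumes qm: "quasi_model n c g d W" and n: "0 < n" "c \<le> n" "g \<le> n" "d \<le> n"
    and c: "c = list_encode (map fm_code cs)" and g: "g = list_encode (map lfm_code gs)"
    and d: "d = list_encode (map lfm_code ds)"
  shows "\<not> G3S4LP (set cs) (mset gs) (mset ds)"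
proof
  have c_less: "x < n" if "codes_mem x c" for x using codes_mem_less[OF that] n by simp
  have g_less: "x < n" if "codes_mem x g" for x using codes_mem_less[OF that] n by simp
  have d_less: "x < n" if "codes_mem x d" for x using codes_mem_less[OF that] n by simp
  interpret kripke_model "{A. codes_mem (fm_code A) c}" "set_decode W" acc "evid n"
      "\<lambda>w p. itT w (pe 0 p)"
    by (rule quasi_model_kripke[OF qm]) (rule c_less)
  have CS: "{A. codes_mem (fm_code A) c} = set cs"
    using codes_mem_list_encode_map[OF inj_codes(1)] unfolding c by blast
  \<comment> \<open>Labels outside the range are sent to a world naming 0, which exists because
    \<open>0 < n\<close>.\<close>
  define \<rho> where "\<rho> l = (SOME w. w \<in> set_decode W \<and> itM w (if l < n then l else 0))" for l
  have \<rho>: "\<rho> l \<in> set_decode W \<and> itM (\<rho> l) (if l < n then l else 0)" for l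
    unfolding \<rho>_def by (rule someI_ex) (use quasi_modelD(1)[OF qm] n(1) in auto)
  have in_W: "\<rho> l \<in> set_decode W" for l using \<rho> by blast
  have named: "itM (\<rho> l) l" if "l < n" for l using \<rho>[of l] that by simp
  have ok: "ev_ok n (\<rho> l)" "modal_ok n W (\<rho> l)" "input_ok n c g d (\<rho> l)" for l
    using quasi_modelD(2)[OF qm in_W] by blast+
  note input = input_okD(2)[OF ok(3) _ named]
  note truth = truth_lemma[OF qm c_less in_W]
  have rel: "acc (\<rho> l) (\<rho> k) \<longleftrightarrow> itS (\<rho> k) l" if "l < n" for l k
  proof
    assume "acc (\<rho> l) (\<rho> k)"
    then show "itS (\<rho> k) l" using modal_okD(6)[OF ok(2) that named[OF that]] by (simp add: acc_iff)
  next
    assume "itS (\<rho> k) l"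
    then show "acc (\<rho> l) (\<rho> k)" by (rule modal_okD(7)[OF ok(2) that named[OF that] in_W])
  qed
  have lt: "l < n" "a < n" if "pe j (pe l a) < n" for j l a
    using that le_prod_encode_1[of l a] le_prod_encode_2[of a l] le_prod_encode_2[of "pe l a" j]
    by linarith+
  have lt_ev: "l < n" "t < n" "a < n" if "pe j (pe l (pe t a)) < n" for j l t a
    using lt[OF that] le_prod_encode_1[of t a] le_prod_encode_2[of a t] by linarith+
  assume "G3S4LP (set cs) (mset gs) (mset ds)"
  then have "\<exists>X\<in>#mset ds. sat \<rho> X"
  proof (rule soundness[unfolded CS])
    show "range \<rho> \<subseteq> set_decode W" using in_W by blast
    show "\<forall>X\<in>#mset gs. sat \<rho> X"
    proof
      fix X assume "X \<in># mset gs"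
      then have X: "codes_mem (lfm_code X) g"
        using codes_mem_list_encode_map[OF inj_codes(2)] unfolding g by simp
      note X_less = g_less[OF X]
      show "sat \<rho> X"
      proof (cases X)
        case (Forces w A)
        then have "w < n" "fm_code A < n" using X_less lt[of 0 w "fm_code A"] by simp_all
        then show ?thesis using X Forces input truth by simp
      next
        case (Rel w v)
        then have "w < n" "v < n" using X_less lt[of 1 w v] by simp_all
        then show ?thesis using X Rel input[of v] rel by simp
      next
        case (Ev w t A)
        then have w: "w < n" "tm_code t < n" "fm_code A < n"
          using X_less lt_ev[of 2 w "tm_code t" "fm_code A"] by auto
        then have "itE (\<rho> w) (tm_code t) (fm_code A)" using X Ev input[of w] by simp
        then show ?thesis using Ev w by (simp add: evid.base)
      qed
    qed
  qed
  then obtain X where "X \<in> set ds" and sat: "sat \<rho> X" by auto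
  then have X: "codes_mem (lfm_code X) d"
    using codes_mem_list_encode_map[OF inj_codes(2)] unfolding d by simp
  note X_less = d_less[OF X]
  show False
  proof (cases X)
    case (Forces w A)
    then have "w < n" "fm_code A < n" using X_less lt[of 0 w "fm_code A"] by simp_all
    then show ?thesis using X Forces input truth sat by auto
  next
    case (Rel w v)
    then have "w < n" "v < n" using X_less lt[of 1 w v] by simp_all
    then show ?thesis using X Rel input[of v] rel sat by simp
  next
    case (Ev w t A)
    then have w: "w < n" "tm_code t < n" "fm_code A < n"
      using X_less lt_ev[of 2 w "tm_code t" "fm_code A"] by auto
    then have "itE (\<rho> w) (tm_code t) (fm_code A)"
      using evid_conservative[OF ok(1), of w t A] sat Ev by auto
    then show ?thesis using X Ev w input[of w] by simp
  qed
qed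


section \<open>Completeness\<close>

text \<open>
  \<open>Lt X\<close> and \<open>Rt X\<close> decompose the principal formula \<open>X\<close> of a consuming rule; \<open>Add X\<close> handles all
  rules that only add \<open>X\<close> to the antecedent.
\<close>

datatype task = Lt lfm | Rt lfm | Add lfm

text \<open>The last clause covers antecedent formulas that no rule consumes: treating them means
  keeping them.\<close>

fun redL :: "lfm set \<Rightarrow> lfm set \<Rightarrow> lfm \<Rightarrow> bool" where
  "redL G D (Forces w (Neg A)) \<longleftrightarrow> Forces w A \<in> D"
| "redL G D (Forces w (Conj A B)) \<longleftrightarrow> Forces w A \<in> G \<and> Forces w B \<in> G"
| "redL G D (Forces w (Disj A B)) \<longleftrightarrow> Forces w A \<in> G \<or> Forces w B \<in> G"
| "redL G D (Forces w (Imp A B)) \<longleftrightarrow> Forces w A \<in> D \<or> Forces w B \<in> G"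
| "redL G D X \<longleftrightarrow> X \<in> G"

fun redR :: "lfm set \<Rightarrow> lfm set \<Rightarrow> lfm \<Rightarrow> bool" where
  "redR G D (Forces w (Neg A)) \<longleftrightarrow> Forces w A \<in> G"
| "redR G D (Forces w (Conj A B)) \<longleftrightarrow> Forces w A \<in> D \<or> Forces w B \<in> D"
| "redR G D (Forces w (Disj A B)) \<longleftrightarrow> Forces w A \<in> D \<and> Forces w B \<in> D"
| "redR G D (Forces w (Imp A B)) \<longleftrightarrow> Forces w A \<in> G \<and> Forces w B \<in> D"
| "redR G D (Forces w (Box A)) \<longleftrightarrow> (\<exists>v. Rel w v \<in> G \<and> Forces v A \<in> D)"
| "redR G D (Forces w (Just t A)) \<longleftrightarrow> (\<exists>v. Rel w v \<in> G \<and> Forces v A \<in> D)"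
| "redR G D X \<longleftrightarrow> X \<in> D"

text \<open>The rule (R:) is applicable only in the presence of the matching evidence atom.\<close>

fun blocked :: "lfm set \<Rightarrow> lfm \<Rightarrow> bool" where
  "blocked G (Forces w (Just t A)) \<longleftrightarrow> Ev w t A \<notin> G"
| "blocked G X \<longleftrightarrow> False"

text \<open>An addition also counts as performed when it would make the sequent derivable. This
  spares a test for applicability: if the adding rule applies to an underivable sequent, only the
  second alternative remains.\<close>

fun performed ::
  "fm set \<Rightarrow> task \<Rightarrow> lfm multiset \<Rightarrow> lfm multiset \<Rightarrow> lfm multiset \<Rightarrow> lfm multiset \<Rightarrow> bool" where
  "performed CS (Add X) \<Gamma> \<Delta> \<Gamma>' \<Delta>' \<longleftrightarrow> G3S4LP CS (add_mset X \<Gamma>) \<Delta> \<or> X \<in># \<Gamma>'"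
| "performed CS (Lt X) \<Gamma> \<Delta> \<Gamma>' \<Delta>' \<longleftrightarrow> (X \<in># \<Gamma> \<longrightarrow> redL (set_mset \<Gamma>') (set_mset \<Delta>') X)"
| "performed CS (Rt X) \<Gamma> \<Delta> \<Gamma>' \<Delta>' \<longleftrightarrow> (X \<in># \<Delta> \<longrightarrow>
     (if blocked (set_mset \<Gamma>) X then X \<in># \<Delta>' else redR (set_mset \<Gamma>') (set_mset \<Delta>') X))"

definition step ::
  "fm set \<Rightarrow> task \<Rightarrow> lfm multiset \<Rightarrow> lfm multiset \<Rightarrow> lfm multiset \<Rightarrow> lfm multiset \<Rightarrow> bool" where
  "step CS \<tau> \<Gamma> \<Delta> \<Gamma>' \<Delta>' \<longleftrightarrow> performed CS \<tau> \<Gamma> \<Delta> \<Gamma>' \<Delta>' \<and>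
    (\<forall>X\<in>#\<Gamma>. X \<in># \<Gamma>' \<or> \<tau> = Lt X) \<and> (\<forall>X\<in>#\<Delta>. X \<in># \<Delta>' \<or> \<tau> = Rt X)"

section \<open>Steps of root-first search\<close>

lemma fresh_exists: "\<exists>v. fresh v \<Gamma> \<Delta>"
proof -
  have "finite (\<Union>X\<in>set_mset (\<Gamma> + \<Delta>). labels X)"
    by (intro finite_UN_I finite_set_mset) (metis finite.emptyI finite.insertI labels.elims)
  then obtain v where "v \<notin> (\<Union>X\<in>set_mset (\<Gamma> + \<Delta>). labels X)"
    using ex_new_if_finite[OF infinite_UNIV_nat] by blast
  then show ?thesis by (auto simp: fresh_def)
qed

lemma stepI_left:
  assumes "\<Gamma> = add_mset X \<Gamma>0" "\<not> G3S4LP CS \<Gamma>' \<Delta>'" "redL (set_mset \<Gamma>') (set_mset \<Delta>') X"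
    "set_mset \<Gamma>0 \<subseteq> set_mset \<Gamma>'" "set_mset \<Delta> \<subseteq> set_mset \<Delta>'"
  shows "\<exists>\<Gamma>' \<Delta>'. \<not> G3S4LP CS \<Gamma>' \<Delta>' \<and> step CS (Lt X) \<Gamma> \<Delta> \<Gamma>' \<Delta>'"
  using assms by (intro exI[of _ \<Gamma>'] exI[of _ \<Delta>']) (auto simp: step_def)

lemma stepI_right:
  assumes "\<Delta> = add_mset X \<Delta>0" "\<not> blocked (set_mset \<Gamma>) X"
    "\<not> G3S4LP CS \<Gamma>' \<Delta>'" "redR (set_mset \<Gamma>') (set_mset \<Delta>') X"
    "set_mset \<Gamma> \<subseteq> set_mset \<Gamma>'" "set_mset \<Delta>0 \<subseteq> set_mset \<Delta>'"
  shows "\<exists>\<Gamma>' \<Delta>'. \<not> G3S4LP CS \<Gamma>' \<Delta>' \<and> step CS (Rt X) \<Gamma> \<Delta> \<Gamma>' \<Delta>'"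
  using assms by (intro exI[of _ \<Gamma>'] exI[of _ \<Delta>']) (auto simp: step_def)

lemma step_idle:
  assumes "\<not> G3S4LP CS \<Gamma> \<Delta>" "performed CS \<tau> \<Gamma> \<Delta> \<Gamma> \<Delta>"
  shows "\<exists>\<Gamma>' \<Delta>'. \<not> G3S4LP CS \<Gamma>' \<Delta>' \<and> step CS \<tau> \<Gamma> \<Delta> \<Gamma>' \<Delta>'"
  using assms by (auto simp: step_def)

text \<open>The contrapositive of the left rule for \<open>X\<close>: an underivable conclusion has
  an underivable premise. If no rule consumes \<open>X\<close>, the search idles.\<close>

lemma step_exists_left:
  assumes nd: "\<not> G3S4LP CS \<Gamma> \<Delta>"
  shows "\<exists>\<Gamma>' \<Delta>'. \<not> G3S4LP CS \<Gamma>' \<Delta>' \<and> step CS (Lt X) \<Gamma> \<Delta> \<Gamma>' \<Delta>'"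
proof (cases "X \<in># \<Gamma>")
  case False
  then show ?thesis using step_idle[OF nd] by simp
next
  case True
  define \<Gamma>0 where "\<Gamma>0 = \<Gamma> - {#X#}"
  have \<Gamma>: "\<Gamma> = add_mset X \<Gamma>0" using True by (simp add: \<Gamma>0_def)
  show ?thesis
  proof (cases X)
    case (Forces w C)
    show ?thesis
    proof (cases C)
      case (Neg A)
      have "\<not> G3S4LP CS \<Gamma>0 (add_mset (Forces w A) \<Delta>)" using nd LNeg \<Gamma> Forces Neg by blast
      then show ?thesis by (rule stepI_left[OF \<Gamma>]) (auto simp: Forces Neg)
    next
      case (Conj A B)
      have "\<not> G3S4LP CS (add_mset (Forces w A) (add_mset (Forces w B) \<Gamma>0)) \<Delta>"
        using nd LConj \<Gamma> Forces Conj by blast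
      then show ?thesis
        by (rule stepI_left[OF \<Gamma>]) (auto simp: Forces Conj)
    next
      case (Disj A B)
      consider "\<not> G3S4LP CS (add_mset (Forces w A) \<Gamma>0) \<Delta>" | "\<not> G3S4LP CS (add_mset (Forces w B) \<Gamma>0) \<Delta>"
        using nd LDisj \<Gamma> Forces Disj by blast
      then show ?thesis by cases (rule stepI_left[OF \<Gamma>], assumption, (auto simp: Forces Disj)[3])+
    next
      case (Imp A B)
      consider "\<not> G3S4LP CS \<Gamma>0 (add_mset (Forces w A) \<Delta>)" | "\<not> G3S4LP CS (add_mset (Forces w B) \<Gamma>0) \<Delta>"
        using nd LImp \<Gamma> Forces Imp by blast
      then show ?thesis by cases (rule stepI_left[OF \<Gamma>], assumption, (auto simp: Forces Imp)[3])+
    qed (use True Forces in \<open>auto intro: step_idle[OF nd]\<close>)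
  qed (use True in \<open>auto intro: step_idle[OF nd]\<close>)
qed

lemma step_exists_right:
  assumes nd: "\<not> G3S4LP CS \<Gamma> \<Delta>"
  shows "\<exists>\<Gamma>' \<Delta>'. \<not> G3S4LP CS \<Gamma>' \<Delta>' \<and> step CS (Rt X) \<Gamma> \<Delta> \<Gamma>' \<Delta>'"
proof (cases "X \<in># \<Delta> \<and> \<not> blocked (set_mset \<Gamma>) X")
  case False
  then show ?thesis using step_idle[OF nd] by simp
next
  case True
  then have X: "X \<in># \<Delta>" and nb: "\<not> blocked (set_mset \<Gamma>) X" by auto
  define \<Delta>0 where "\<Delta>0 = \<Delta> - {#X#}"
  have \<Delta>: "\<Delta> = add_mset X \<Delta>0" using X by (simp add: \<Delta>0_def)
  note stepI = stepI_right[OF \<Delta> nb]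
  obtain v where v: "fresh v \<Gamma> \<Delta>" using fresh_exists by blast
  show ?thesis
  proof (cases X)
    case (Forces w C)
    show ?thesis
    proof (cases C)
      case (Neg A)
      have "\<not> G3S4LP CS (add_mset (Forces w A) \<Gamma>) \<Delta>0" using nd RNeg \<Delta> Forces Neg by blast
      then show ?thesis by (rule stepI) (auto simp: Forces Neg)
    next
      case (Conj A B)
      consider "\<not> G3S4LP CS \<Gamma> (add_mset (Forces w A) \<Delta>0)" | "\<not> G3S4LP CS \<Gamma> (add_mset (Forces w B) \<Delta>0)"
        using nd RConj \<Delta> Forces Conj by blast
      then show ?thesis by cases (rule stepI, assumption, (auto simp: Forces Conj)[3])+
    next
      case (Disj A B)
      have "\<not> G3S4LP CS \<Gamma> (add_mset (Forces w A) (add_mset (Forces w B) \<Delta>0))"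
        using nd RDisj \<Delta> Forces Disj by blast
      then show ?thesis
        by (rule stepI) (auto simp: Forces Disj)
    next
      case (Imp A B)
      have "\<not> G3S4LP CS (add_mset (Forces w A) \<Gamma>) (add_mset (Forces w B) \<Delta>0)"
        using nd RImp \<Delta> Forces Imp by blast
      then show ?thesis by (rule stepI) (auto simp: Forces Imp)
    next
      case (Box A)
      have "\<not> G3S4LP CS (add_mset (Rel w v) \<Gamma>) (add_mset (Forces v A) \<Delta>0)"
        using nd RBox v \<Delta> Forces Box by blast
      then show ?thesis by (rule stepI) (auto simp: Forces Box)
    next
      case (Just t A)
      then have "Ev w t A \<in># \<Gamma>" using nb Forces by simp
      then obtain \<Gamma>0 where "\<Gamma> = add_mset (Ev w t A) \<Gamma>0" by (metis insert_DiffM)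
      then have "\<not> G3S4LP CS (add_mset (Rel w v) \<Gamma>) (add_mset (Forces v A) \<Delta>0)"
        using nd RJust v \<Delta> Forces Just by blast
      then show ?thesis by (rule stepI) (auto simp: Forces Just)
    qed (use X Forces in \<open>auto intro: step_idle[OF nd]\<close>)
  qed (use X in \<open>auto intro: step_idle[OF nd]\<close>)
qed

lemma step_exists:
  assumes nd: "\<not> G3S4LP CS \<Gamma> \<Delta>"
  shows "\<exists>\<Gamma>' \<Delta>'. \<not> G3S4LP CS \<Gamma>' \<Delta>' \<and> step CS \<tau> \<Gamma> \<Delta> \<Gamma>' \<Delta>'"
proof (cases \<tau>)
  case (Add X)
  show ?thesis
  proof (cases "G3S4LP CS (add_mset X \<Gamma>) \<Delta>")
    case True
    then show ?thesis using step_idle[OF nd] Add by simp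
  next
    case False
    then show ?thesis using Add by (intro exI[of _ "add_mset X \<Gamma>"] exI[of _ \<Delta>]) (auto simp: step_def)
  qed
qed (use step_exists_left[OF nd] step_exists_right[OF nd] in auto)

text \<open>Stage \<open>pe (code \<tau>) i\<close> is assigned to \<open>\<tau>\<close> and is at
  least \<open>i\<close>, so every task recurs forever.\<close>

lemma fair_schedule: "\<exists>\<sigma> :: nat \<Rightarrow> task. \<forall>\<tau> i. \<exists>k\<ge>i. \<sigma> k = \<tau>"
proof -
  define code :: "task \<Rightarrow> nat" where
    "code \<tau> = (case \<tau> of Lt X \<Rightarrow> pe 0 (lfm_code X) | Rt X \<Rightarrow> pe 1 (lfm_code X) | Add X \<Rightarrow> pe 2 (lfm_code X))"
    for \<tau>
  have "inj code"
    by (rule injI) (auto simp: code_def split: task.splits dest: lfm_code_inject)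
  then have "inv code (fst (prod_decode (pe (code \<tau>) i))) = \<tau>" for \<tau> i by simp
  then show ?thesis
    by (intro exI[of _ "\<lambda>k. inv code (fst (prod_decode k))"]) (metis le_prod_encode_2)
qed

locale saturated =
  fixes CS :: "fm set" and G D :: "lfm set"
  assumes var_clash: "Forces w (PVar p) \<in> G \<Longrightarrow> Forces w (PVar p) \<in> D \<Longrightarrow> False"
    and no_Bot: "Forces w Bot \<in> G \<Longrightarrow> False"
    and Rel_clash: "Rel w v \<in> G \<Longrightarrow> Rel w v \<in> D \<Longrightarrow> False"
    and Ev_clash: "Ev w t A \<in> G \<Longrightarrow> Ev w t A \<in> D \<Longrightarrow> False"
    and left: "X \<in> G \<Longrightarrow> redL G D X"
    and right: "X \<in> D \<Longrightarrow> redR G D X \<or> blocked G X"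
    and left_Box: "Forces w (Box A) \<in> G \<Longrightarrow> Rel w v \<in> G \<Longrightarrow> Forces v A \<in> G"
    and left_Just: "Forces w (Just t A) \<in> G \<Longrightarrow> Rel w v \<in> G \<Longrightarrow> Forces v A \<in> G"
    and Ev_Just: "Forces w (Just t A) \<in> G \<Longrightarrow> Ev w t A \<in> G"
    and Ev_Plus1: "Ev w t A \<in> G \<Longrightarrow> Ev w (Plus s t) A \<in> G"
    and Ev_Plus2: "Ev w t A \<in> G \<Longrightarrow> Ev w (Plus t s) A \<in> G"
    and Ev_App: "Ev w s (Imp A B) \<in> G \<Longrightarrow> Ev w t A \<in> G \<Longrightarrow> Ev w (App s t) B \<in> G"
    and Ev_Bang: "Ev w t A \<in> G \<Longrightarrow> Ev w (Bang t) (Just t A) \<in> G"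
    and Ev_mono: "Ev w t A \<in> G \<Longrightarrow> Rel w v \<in> G \<Longrightarrow> Ev v t A \<in> G"
    and Ev_const: "Just (JConst c) A \<in> CS \<Longrightarrow> Ev w (JConst c) A \<in> G"
    and Rel_refl: "Rel w w \<in> G"
    and Rel_trans: "Rel w v \<in> G \<Longrightarrow> Rel v u \<in> G \<Longrightarrow> Rel w u \<in> G"

lemma redL_mono: "redL G D X \<Longrightarrow> G \<subseteq> G' \<Longrightarrow> D \<subseteq> D' \<Longrightarrow> redL G' D' X"
  by (induction G D X rule: redL.induct) auto

lemma redR_mono: "redR G D X \<Longrightarrow> G \<subseteq> G' \<Longrightarrow> D \<subseteq> D' \<Longrightarrow> redR G' D' X"
  by (induction G D X rule: redR.induct) auto

fun persistent :: "lfm \<Rightarrow> bool" where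
  "persistent (Forces w (PVar p)) = True"
| "persistent (Forces w Bot) = True"
| "persistent (Forces w (Box A)) = True"
| "persistent (Forces w (Just t A)) = True"
| "persistent (Forces w A) = False"
| "persistent (Rel w v) = True"
| "persistent (Ev w t A) = True"

lemma redL_persistent: "persistent X \<Longrightarrow> redL G D X \<Longrightarrow> X \<in> G"
  by (induction X rule: persistent.induct) auto

text \<open>Distinctness is essential: one occurrence cannot serve as both principal formulas of a
  rule.\<close>

lemma mset_split2:
  assumes "X \<in># M" "Y \<in># M" "X \<noteq> Y"
  obtains N where "M = add_mset X (add_mset Y N)"
  using assms by (metis insert_DiffM insert_noteq_member)

theorem saturation:
  assumes nd: "\<not> G3S4LP CS \<Gamma> \<Delta>"
  obtains G D where "saturated CS G D" "set_mset \<Gamma> \<subseteq> G" "set_mset \<Delta> \<subseteq> D"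
proof -
  obtain \<sigma> :: "nat \<Rightarrow> task" where \<sigma>: "\<And>\<tau> i. \<exists>k\<ge>i. \<sigma> k = \<tau>" using fair_schedule by blast
  have "\<exists>S. \<forall>i. (\<not> G3S4LP CS (fst (S i)) (snd (S i)) \<and> (i = 0 \<longrightarrow> S i = (\<Gamma>, \<Delta>))) \<and>
      step CS (\<sigma> i) (fst (S i)) (snd (S i)) (fst (S (Suc i))) (snd (S (Suc i)))"
    by (rule dependent_nat_choice) (use nd step_exists in \<open>force+\<close>)
  then obtain S where S: "\<And>i. \<not> G3S4LP CS (fst (S i)) (snd (S i))" "S 0 = (\<Gamma>, \<Delta>)"
    "\<And>i. step CS (\<sigma> i) (fst (S i)) (snd (S i)) (fst (S (Suc i))) (snd (S (Suc i)))" by blast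
  define g where "g i = fst (S i)" for i
  define d where "d i = snd (S i)" for i
  have nd: "\<not> G3S4LP CS (g i) (d i)" for i using S(1) by (simp add: g_def d_def)
  have st: "performed CS (\<sigma> i) (g i) (d i) (g (Suc i)) (d (Suc i))"
      "X \<in># g i \<Longrightarrow> X \<in># g (Suc i) \<or> \<sigma> i = Lt X"
      "X \<in># d i \<Longrightarrow> X \<in># d (Suc i) \<or> \<sigma> i = Rt X" for i X
    using S(3)[of i] by (simp_all add: step_def g_def d_def)
  define G where "G = (\<Union>i. set_mset (g i))"
  define D where "D = (\<Union>i. set_mset (d i))"
  have sub: "set_mset (g i) \<subseteq> G" "set_mset (d i) \<subseteq> D" for i by (auto simp: G_def D_def)
  have persist: "X \<in># g j" if "X \<in># g i" "persistent X" "i \<le> j" for X i j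
    using that(3,1)
  proof (induction rule: dec_induct)
    case (step k)
    then show ?case using st(1)[of k] st(2)[of X k] redL_persistent[OF that(2)] by auto
  qed
  have keep_or_treat: "(\<exists>k\<ge>i. \<sigma> k = Rt X \<and> X \<in># d k \<and> X \<notin># d (Suc k)) \<or> (\<forall>j\<ge>i. X \<in># d j)"
    if X: "X \<in># d i" for X i
  proof (rule disjCI)
    assume no: "\<not> (\<forall>j\<ge>i. X \<in># d j)"
    show "\<exists>k\<ge>i. \<sigma> k = Rt X \<and> X \<in># d k \<and> X \<notin># d (Suc k)"
    proof (rule ccontr)
      assume neg: "\<not> ?thesis"
      have "X \<in># d j" if "i \<le> j" for j
        using that X
      proof (induction rule: dec_induct)
        case (step k)
        then show ?case using neg st(3)[of X k] by blast
      qed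
      then show False using no by blast
    qed
  qed
  have left: "redL G D X" if X: "X \<in> G" for X
  proof -
    obtain i where i: "X \<in># g i" using X by (auto simp: G_def)
    have "\<exists>k\<ge>i. \<sigma> k = Lt X \<and> X \<in># g k"
    proof (rule ccontr)
      assume neg: "\<not> ?thesis"
      have "X \<in># g j" if "i \<le> j" for j
        using that i
      proof (induction rule: dec_induct)
        case (step k)
        then show ?case using neg st(2)[of X k] by blast
      qed
      then show False using neg \<sigma>[of i "Lt X"] by blast
    qed
    then obtain k where "\<sigma> k = Lt X" "X \<in># g k" by blast
    then have "redL (set_mset (g (Suc k))) (set_mset (d (Suc k))) X" using st(1)[of k] by simp
    then show ?thesis using sub by (rule redL_mono)
  qed
  have right: "redR G D X \<or> blocked G X" if X: "X \<in> D" for X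
  proof (rule disjCI)
    assume "\<not> blocked G X"
    then have "\<exists>m. \<forall>j\<ge>m. \<not> blocked (set_mset (g j)) X"
    proof (cases "\<exists>w t A. X = Forces w (Just t A)")
      case True
      then obtain w t A where Just: "X = Forces w (Just t A)" by blast
      then obtain m where "Ev w t A \<in># g m" using \<open>\<not> blocked G X\<close> by (auto simp: G_def)
      \<comment> \<open>Once the evidence atom has appeared it stays, so (R:) is never blocked
        again.\<close>
      then show ?thesis using persist[of "Ev w t A" m] Just by auto
    next
      case False
      then have "\<not> blocked H X" for H by (auto elim: blocked.elims(2))
      then show ?thesis by blast
    qed
    then obtain m where m: "\<And>j. m \<le> j \<Longrightarrow> \<not> blocked (set_mset (g j)) X" by blast
    obtain i where i: "X \<in># d i" using X by (auto simp: D_def)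
    \<comment> \<open>If \<open>X\<close> stays forever, its task recurs after stage
      \<open>m\<close>, when it is unblocked. Otherwise the step removing it must have decomposed
      it, since a blocked formula is kept.\<close>
    have "\<exists>k. \<sigma> k = Rt X \<and> X \<in># d k \<and> (\<not> blocked (set_mset (g k)) X \<or> X \<notin># d (Suc k))"
    proof (cases "\<forall>j\<ge>i. X \<in># d j")
      case True
      obtain k where "k \<ge> max i m" "\<sigma> k = Rt X" using \<sigma> by blast
      then show ?thesis using True m[of k] by auto
    qed (use keep_or_treat[OF i] in blast)
    then obtain k where "\<sigma> k = Rt X" "X \<in># d k" "\<not> blocked (set_mset (g k)) X \<or> X \<notin># d (Suc k)"
      by blast
    then have "redR (set_mset (g (Suc k))) (set_mset (d (Suc k))) X"
      using st(1)[of k] by (auto split: if_splits)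
    then show "redR G D X" using sub by (rule redR_mono)
  qed
  have add: "X \<in> G" if "\<And>k. m \<le> k \<Longrightarrow> G3S4LP CS (add_mset X (g k)) (d k) \<Longrightarrow> G3S4LP CS (g k) (d k)"
    for X and m :: nat
  proof -
    obtain k where "k \<ge> m" "\<sigma> k = Add X" using \<sigma> by blast
    then have "X \<in># g (Suc k)" using st(1)[of k] nd[of k] that[of k] by auto
    then show ?thesis using sub by blast
  qed
  have add1: "X \<in> G" if Y: "Y \<in> G" "persistent Y"
    "\<And>\<Gamma> \<Delta>. G3S4LP CS (add_mset X (add_mset Y \<Gamma>)) \<Delta> \<Longrightarrow> G3S4LP CS (add_mset Y \<Gamma>) \<Delta>" for X Y
  proof -
    obtain m where "Y \<in># g m" using Y(1) by (auto simp: G_def)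
    then have "Y \<in># g k" if "m \<le> k" for k using persist Y(2) that by blast
    then show ?thesis using add[of m X] Y(3) by (metis insert_DiffM)
  qed
  have add2: "X \<in> G" if YZ: "Y \<in> G" "persistent Y" "Z \<in> G" "persistent Z" "Y \<noteq> Z"
    "\<And>\<Gamma> \<Delta>. G3S4LP CS (add_mset X (add_mset Y (add_mset Z \<Gamma>))) \<Delta> \<Longrightarrow>
      G3S4LP CS (add_mset Y (add_mset Z \<Gamma>)) \<Delta>" for X Y Z
  proof -
    obtain m1 m2 where "Y \<in># g m1" "Z \<in># g m2" using YZ(1,3) by (auto simp: G_def)
    then have "Y \<in># g k" "Z \<in># g k" if "max m1 m2 \<le> k" for k
      using persist that YZ(2,4) by (metis max.boundedE)+
    then show ?thesis using add[of "max m1 m2" X] YZ(5,6) by (metis mset_split2)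
  qed
  \<comment> \<open>Both occurrences survive: \<open>X\<close> is persistent on the left and is
    never decomposed on the right. They meet at one stage, which would be an initial
    sequent.\<close>
  have atoms: False if X: "X \<in> G" "X \<in> D" "persistent X"
    "\<And>\<Gamma> \<Delta>. G3S4LP CS (add_mset X \<Gamma>) (add_mset X \<Delta>)"
    "\<And>G D. redR G D X \<longleftrightarrow> X \<in> D" "\<And>G. \<not> blocked G X" for X
  proof -
    obtain i j where "X \<in># g i" "X \<in># d j" using X(1,2) by (auto simp: G_def D_def)
    moreover have "X \<in># d k" if "j \<le> k" for k
      using that \<open>X \<in># d j\<close>
    proof (induction rule: dec_induct)
      case (step k)
      then show ?case using st(1)[of k] st(3)[of X k] X(5,6)
        by auto
    qed
    ultimately have "X \<in># g (max i j)" "X \<in># d (max i j)" using persist[of X i] X(3) by auto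
    then show False using X(4) nd[of "max i j"] by (metis insert_DiffM)
  qed
  have "saturated CS G D"
  proof unfold_locales
    fix w assume "Forces w Bot \<in> G"
    then obtain i where "Forces w Bot \<in># g i" by (auto simp: G_def)
    then show False using nd[of i] InitBot by (metis insert_DiffM)
  next
    fix w v u assume *: "Rel w v \<in> G" "Rel v u \<in> G"
    show "Rel w u \<in> G"
    \<comment> \<open>If the two atoms coincide, all three labels are equal and the desired atom is
      already present; this avoids contraction.\<close>
    proof (cases "Rel w v = Rel v u")
      case False
      show ?thesis by (rule add2[OF *(1) _ *(2) _ False]; (erule G3S4LP.Trans | simp))
    qed (use * in simp)
  next
    fix w s t A B assume *: "Ev w s (Imp A B) \<in> G" "Ev w t A \<in> G"
    show "Ev w (App s t) B \<in> G" by (rule add2[OF *(1) _ *(2)]; (erule G3S4LP.EApp | simp))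
  next
    fix w v A assume *: "Forces w (Box A) \<in> G" "Rel w v \<in> G"
    show "Forces v A \<in> G" by (rule add2[OF *(1) _ *(2)]; (erule G3S4LP.LBox | simp))
  next
    fix w v t A assume *: "Forces w (Just t A) \<in> G" "Rel w v \<in> G"
    show "Forces v A \<in> G" by (rule add2[OF *(1) _ *(2)]; (erule G3S4LP.LJust | simp))
  next
    fix w v t A assume *: "Ev w t A \<in> G" "Rel w v \<in> G"
    show "Ev v t A \<in> G" by (rule add2[OF *(1) _ *(2)]; (erule G3S4LP.Mon | simp))
  next
    fix w t A assume *: "Forces w (Just t A) \<in> G"
    show "Ev w t A \<in> G" by (rule add1[OF *]; (erule G3S4LP.E | simp))
  next
    fix w s t A assume *: "Ev w t A \<in> G"
    show "Ev w (Plus s t) A \<in> G" by (rule add1[OF *]; (erule G3S4LP.ElPlus | simp))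
  next
    fix w s t A assume *: "Ev w t A \<in> G"
    show "Ev w (Plus t s) A \<in> G" by (rule add1[OF *]; (erule G3S4LP.ErPlus | simp))
  next
    fix w t A assume *: "Ev w t A \<in> G"
    show "Ev w (Bang t) (Just t A) \<in> G" by (rule add1[OF *]; (erule G3S4LP.EBang | simp))
  next
    fix w c A assume *: "Just (JConst c) A \<in> CS"
    show "Ev w (JConst c) A \<in> G" by (rule add[of 0]) (rule G3S4LP.AN[OF _ *])
  next
    fix w show "Rel w w \<in> G" by (rule add[of 0]) (rule G3S4LP.Ref)
  next
    fix w p assume *: "Forces w (PVar p) \<in> G" "Forces w (PVar p) \<in> D"
    show False by (rule atoms[OF *]; (rule G3S4LP.InitP | simp))
  next
    fix w v assume *: "Rel w v \<in> G" "Rel w v \<in> D"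
    show False by (rule atoms[OF *]; (rule G3S4LP.InitR | simp))
  next
    fix w t A assume *: "Ev w t A \<in> G" "Ev w t A \<in> D"
    show False by (rule atoms[OF *]; (rule G3S4LP.InitE | simp))
  qed (fact left right)+
  moreover have "set_mset \<Gamma> \<subseteq> G" "set_mset \<Delta> \<subseteq> D"
    using sub[of 0] S(2) by (simp_all add: g_def d_def)
  ultimately show thesis by (rule that)
qed


section \<open>Filtration\<close>

lemma fm_code_eq_iff:
  "pe 0 a = fm_code A \<longleftrightarrow> A = PVar a"
  "pe 1 a = fm_code A \<longleftrightarrow> A = Bot \<and> a = 0"
  "pe 2 a = fm_code A \<longleftrightarrow> (\<exists>B. A = Neg B \<and> a = fm_code B)"
  "pe 3 (pe a b) = fm_code A \<longleftrightarrow> (\<exists>B C. A = Conj B C \<and> a = fm_code B \<and> b = fm_code C)"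
  "pe 4 (pe a b) = fm_code A \<longleftrightarrow> (\<exists>B C. A = Disj B C \<and> a = fm_code B \<and> b = fm_code C)"
  "pe 5 (pe a b) = fm_code A \<longleftrightarrow> (\<exists>B C. A = Imp B C \<and> a = fm_code B \<and> b = fm_code C)"
  "pe 6 (pe a b) = fm_code A \<longleftrightarrow> (\<exists>t C. A = Just t C \<and> a = tm_code t \<and> b = fm_code C)"
  "pe 7 a = fm_code A \<longleftrightarrow> (\<exists>B. A = Box B \<and> a = fm_code B)"
  by (cases A; auto)+

lemma tm_code_eq_iff:
  "pe 1 a = tm_code t \<longleftrightarrow> t = JConst a"
  "pe 2 (pe a b) = tm_code t \<longleftrightarrow> (\<exists>r s. t = App r s \<and> a = tm_code r \<and> b = tm_code s)"
  "pe 3 (pe a b) = tm_code t \<longleftrightarrow> (\<exists>r s. t = Plus r s \<and> a = tm_code r \<and> b = tm_code s)"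
  "pe 4 a = tm_code t \<longleftrightarrow> (\<exists>s. t = Bang s \<and> a = tm_code s)"
  by (cases t; auto)+

lemma lfm_code_eq_iff:
  "pe 0 (pe w a) = lfm_code X \<longleftrightarrow> (\<exists>A. X = Forces w A \<and> a = fm_code A)"
  "pe 1 (pe w v) = lfm_code X \<longleftrightarrow> X = Rel w v"
  "pe 2 (pe w (pe a b)) = lfm_code X \<longleftrightarrow> (\<exists>t A. X = Ev w t A \<and> a = tm_code t \<and> b = fm_code A)"
  by (cases X; auto)+

definition forced :: "lfm set \<Rightarrow> label \<Rightarrow> nat \<Rightarrow> bool" where
  "forced G w a \<longleftrightarrow> (\<exists>A. a = fm_code A \<and> Forces w A \<in> G)"

text \<open>A box at \<open>u\<close> need not reappear at its successors, since the calculus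
  obtains transitivity from the relational atoms. Looking back to all predecessors yields a property
  that persists.\<close>

definition necessary :: "lfm set \<Rightarrow> label \<Rightarrow> nat \<Rightarrow> bool" where
  "necessary G w a \<longleftrightarrow> (\<exists>A u. a = fm_code A \<and> Rel u w \<in> G \<and>
     (Forces u (Box A) \<in> G \<or> (\<exists>t. Forces u (Just t A) \<in> G)))"

text \<open>
  The closure conditions on evidence quantify over all numbers. Letting a number that codes no
  term be evidence for everything makes them hold for such numbers, too.
\<close>

definition evident :: "lfm set \<Rightarrow> label \<Rightarrow> nat \<Rightarrow> nat \<Rightarrow> bool" where
  "evident G w p a \<longleftrightarrow> (\<forall>t. p = tm_code t \<longrightarrow> (\<exists>A. a = fm_code A \<and> Ev w t A \<in> G))"

lemma tm_code_eq: "tm_code s = tm_code t \<longleftrightarrow> s = t"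
  using tm_code_inject by blast

lemma fm_code_eq: "fm_code A = fm_code B \<longleftrightarrow> A = B"
  using fm_code_inject by blast

lemma evident_tm_code: "evident G w (tm_code t) a \<longleftrightarrow> (\<exists>A. a = fm_code A \<and> Ev w t A \<in> G)"
  unfolding evident_def tm_code_eq by blast

definition items :: "lfm set \<Rightarrow> lfm set \<Rightarrow> nat \<Rightarrow> label \<Rightarrow> nat set" where
  "items G D n w =
    {pe 4 a |a. a < n \<and> forced G w a} \<union>
    {pe 2 a |a. a < n \<and> forced D w a} \<union>
    {pe 3 l |l. l < n \<and> l = w} \<union>
    {pe 0 (pe 0 a) |a. a < n \<and> necessary G w a} \<union>
    {pe 0 (pe 3 (pe t a)) |t a. t < n \<and> a < n \<and> evident G w t a} \<union>
    {pe 0 (pe 2 l) |l. l < n \<and> Rel l w \<in> G}"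

lemma triangle_mono: "a \<le> b \<Longrightarrow> triangle a \<le> triangle b"
  by (induction rule: dec_induct) auto

lemma pe_mono: "a \<le> a' \<Longrightarrow> b \<le> b' \<Longrightarrow> pe a b \<le> pe a' b'"
  unfolding prod_encode_def by (simp add: add_mono triangle_mono)

lemma items_bound: "items G D n w \<subseteq> {..<item_bound n}"
proof -
  have 1: "pe k (pe j (pe t a)) < item_bound n" if "k \<le> 4" "j \<le> 3" "t < n" "a < n" for k j t a
    using that unfolding item_bound_def less_Suc_eq_le by (intro pe_mono) auto
  have 2: "pe k (pe j a) < item_bound n" if "k \<le> 4" "j \<le> 3" "a < n" for k j a
  proof -
    have "pe k (pe j a) \<le> pe k (pe j (pe a a))" by (intro pe_mono le_prod_encode_1) auto
    then show ?thesis using 1[of k j a a] that by simp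
  qed
  have 3: "pe k a < item_bound n" if "k \<le> 4" "a < n" for k a
  proof -
    have "pe k a \<le> pe k (pe 0 a)" by (intro pe_mono le_prod_encode_2) auto
    then show ?thesis using 2[of k 0 a] that by simp
  qed
  show ?thesis unfolding items_def by (auto intro: 1 2 3)
qed

lemma set_encode_less:
  assumes "A \<subseteq> {..<K}" shows "set_encode A < 2 ^ K"
proof -
  have "Suc (set_encode {..<K}) = 2 ^ K" by (induction K) (simp_all add: lessThan_Suc)
  moreover have "set_encode A \<le> set_encode {..<K}"
    using assms finite_subset[OF assms] by (intro subset_decode_imp_le) simp
  ultimately show ?thesis by simp
qed

definition wtype :: "lfm set \<Rightarrow> lfm set \<Rightarrow> nat \<Rightarrow> label \<Rightarrow> nat" where
  "wtype G D n w = set_encode (items G D n w)"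

lemma set_decode_wtype: "set_decode (wtype G D n w) = items G D n w"
  using finite_subset[OF items_bound] unfolding wtype_def by (intro set_encode_inverse) blast

lemma item_iff:
  "itT (wtype G D n w) a \<longleftrightarrow> a < n \<and> forced G w a"
  "itF (wtype G D n w) a \<longleftrightarrow> a < n \<and> forced D w a"
  "itM (wtype G D n w) l \<longleftrightarrow> l < n \<and> l = w"
  "itN (wtype G D n w) a \<longleftrightarrow> a < n \<and> necessary G w a"
  "itE (wtype G D n w) t a \<longleftrightarrow> t < n \<and> a < n \<and> evident G w t a"
  "itS (wtype G D n w) l \<longleftrightarrow> l < n \<and> Rel l w \<in> G"
  unfolding set_decode_wtype items_def by auto

context saturated
begin

text \<open>Only this direction can be expected: unrelated labels may have types that are accessible
  from each other.\<close>

lemma acc_wtype: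
  assumes R: "Rel w v \<in> G"
  shows "acc (wtype G D n w) (wtype G D n v)"
proof -
  have "necessary G v a" if "necessary G w a" for a
    using that R Rel_trans unfolding necessary_def by blast
  moreover have "evident G v t a" if "evident G w t a" for t a
    using that R Ev_mono unfolding evident_def by blast
  moreover have "Rel l v \<in> G" if "Rel l w \<in> G" for l
    using that R Rel_trans by blast
  ultimately show ?thesis
    unfolding acc_iff set_decode_wtype items_def by auto
qed

lemma prop_ok_wtype: "prop_ok n (wtype G D n w)"
proof -
  have var: "\<not> (forced G w (pe 0 p) \<and> forced D w (pe 0 p))" for p
    using var_clash by (auto simp: forced_def fm_code_eq_iff)
  have bot: "\<not> forced G w (pe 1 0)"
    using no_Bot by (auto simp: forced_def fm_code_eq_iff simp del: One_nat_def)
  have neg: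
    "forced G w (pe 2 a) \<Longrightarrow> forced D w a"
    "forced D w (pe 2 a) \<Longrightarrow> forced G w a" for a
    using left[of "Forces w (Neg _)"] right[of "Forces w (Neg _)"]
    unfolding forced_def fm_code_eq_iff redL.simps redR.simps blocked.simps by blast+
  have conj:
    "forced G w (pe 3 (pe a b)) \<Longrightarrow> forced G w a \<and> forced G w b"
    "forced D w (pe 3 (pe a b)) \<Longrightarrow> forced D w a \<or> forced D w b" for a b
    using left[of "Forces w (Conj _ _)"] right[of "Forces w (Conj _ _)"]
    unfolding forced_def fm_code_eq_iff redL.simps redR.simps blocked.simps by blast+
  have disj:
    "forced G w (pe 4 (pe a b)) \<Longrightarrow> forced G w a \<or> forced G w b"
    "forced D w (pe 4 (pe a b)) \<Longrightarrow> forced D w a \<and> forced D w b" for a b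
    using left[of "Forces w (Disj _ _)"] right[of "Forces w (Disj _ _)"]
    unfolding forced_def fm_code_eq_iff redL.simps redR.simps blocked.simps by blast+
  have imp:
    "forced G w (pe 5 (pe a b)) \<Longrightarrow> forced D w a \<or> forced G w b"
    "forced D w (pe 5 (pe a b)) \<Longrightarrow> forced G w a \<and> forced D w b" for a b
    using left[of "Forces w (Imp _ _)"] right[of "Forces w (Imp _ _)"]
    unfolding forced_def fm_code_eq_iff redL.simps redR.simps blocked.simps by blast+
  show ?thesis
    unfolding prop_ok_def item_iff
    using var bot by (auto dest: neg conj disj imp simp del: One_nat_def)
qed

lemma ev_ok_wtype: "ev_ok n (wtype G D n w)"
proof -
  have "evident G w (pe 3 (pe s t)) a" if "evident G w s a \<or> evident G w t a" for s t a
    using that Ev_Plus1 Ev_Plus2 unfolding evident_def tm_code_eq_iff by blast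
  moreover have "evident G w (pe 2 (pe s t)) b"
    if E: "evident G w s (pe 5 (pe a b))" "evident G w t a" for s t a b
    unfolding evident_def
  proof (intro allI impI)
    \<comment> \<open>A number coding an application has components that code terms, so the vacuous
      case of \<open>evident\<close> does not arise for them.\<close>
    fix r assume "pe 2 (pe s t) = tm_code r"
    then obtain s' t' where r: "r = App s' t'" "s = tm_code s'" "t = tm_code t'"
      unfolding tm_code_eq_iff by blast
    with E obtain A B where "Ev w s' (Imp A B) \<in> G" "a = fm_code A" "b = fm_code B"
      by (auto simp: evident_tm_code fm_code_eq_iff)
    moreover from this have "Ev w t' A \<in> G" using E(2) r by (simp add: evident_tm_code fm_code_eq)
    ultimately show "\<exists>B. b = fm_code B \<and> Ev w r B \<in> G" using Ev_App r by blast
  qed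
  moreover have "evident G w (pe 4 t) (pe 6 (pe t a))" if "evident G w t a" for t a
    using that Ev_Bang unfolding evident_def tm_code_eq_iff fm_code_eq_iff by blast
  ultimately show ?thesis unfolding ev_ok_def item_iff by blast
qed

lemma modal_ok_wtype:
  assumes W: "set_decode W = range (wtype G D n)"
  shows "modal_ok n W (wtype G D n w)"
proof -
  have "forced G w a" if "necessary G w a" for a
    using that left_Box left_Just unfolding necessary_def forced_def by blast
  moreover have "necessary G w a" if "forced G w (pe 7 a)" for a
    using that Rel_refl
    by (auto simp: necessary_def forced_def fm_code_eq_iff)
  moreover have "necessary G w a \<and> evident G w t a" if "forced G w (pe 6 (pe t a))" for t a
    using that Rel_refl Ev_Just
    by (auto simp: necessary_def forced_def evident_tm_code fm_code_eq_iff fm_code_eq)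
  moreover have "\<exists>v. acc (wtype G D n w) (wtype G D n v) \<and> forced D v a" if "forced D w (pe 7 a)" for a
    using that right[of "Forces w (Box _)"] acc_wtype
    unfolding forced_def fm_code_eq_iff redR.simps blocked.simps by blast
  moreover have "\<exists>v. acc (wtype G D n w) (wtype G D n v) \<and> forced D v a"
    if F: "forced D w (pe 6 (pe t a))" "evident G w t a" for t a
  proof -
    obtain s A where "Forces w (Just s A) \<in> D" "t = tm_code s" "a = fm_code A"
      using F(1) by (auto simp: forced_def fm_code_eq_iff)
    moreover from this have "Ev w s A \<in> G" using F(2) by (simp add: evident_tm_code fm_code_eq)
    \<comment> \<open>The evidence atom lifts the exemption for blocked formulas, so saturation
      supplies the successor.\<close>
    ultimately obtain v where "Rel w v \<in> G" "Forces v A \<in> D"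
      using right[of "Forces w (Just s A)"] by auto
    then show ?thesis using acc_wtype \<open>a = fm_code A\<close> by (auto simp: forced_def)
  qed
  ultimately show ?thesis
    unfolding modal_ok_def W ball_simps(9) bex_simps(7) item_iff
    using Rel_refl acc_wtype by blast
qed

end

theorem quasi_model_exists:
  assumes nd: "\<not> G3S4LP (set cs) (mset gs) (mset ds)" and n: "list_encode (map fm_code cs) \<le> n"
  shows "\<exists>W < 2 ^ (2 ^ item_bound n). quasi_model n (list_encode (map fm_code cs))
    (list_encode (map lfm_code gs)) (list_encode (map lfm_code ds)) W"
proof -
  obtain G D where sat: "saturated (set cs) G D" and GD: "set gs \<subseteq> G" "set ds \<subseteq> D"
    using saturation[OF nd] by auto
  interpret saturated "set cs" G D by (rule sat)
  let ?wt = "wtype G D n"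
  define W where "W = set_encode (range ?wt)"
  \<comment> \<open>Infinitely many labels have only finitely many types.\<close>
  have sub: "range ?wt \<subseteq> {..<2 ^ item_bound n}"
    using set_encode_less[OF items_bound] by (auto simp: wtype_def)
  then have "W < 2 ^ (2 ^ item_bound n)" unfolding W_def by (rule set_encode_less)
  moreover have W: "set_decode W = range ?wt"
    unfolding W_def using finite_subset[OF sub] by (intro set_encode_inverse) blast
  moreover have "input_ok n (list_encode (map fm_code cs)) (list_encode (map lfm_code gs))
    (list_encode (map lfm_code ds)) (?wt w)" for w
  proof -
    have mem: "codes_mem x (list_encode (map f xs)) \<longleftrightarrow> (\<exists>y\<in>set xs. x = f y)"
      for f x and xs :: "'a list" by auto
    \<comment> \<open>Recorded evidence needs a term code below \<open>n\<close>; the constant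
      inherits this bound from its formula in \<open>cs\<close>.\<close>
    have const_less: "pe 1 q < n"
      if "codes_mem (pe 6 (pe (pe 1 q) a)) (list_encode (map fm_code cs))" for q a
      using codes_mem_less[OF that] pe2_less[of 6 "pe 1 q" a] n by linarith
    have cs: "evident G w (pe 1 q) a"
      if "codes_mem (pe 6 (pe (pe 1 q) a)) (list_encode (map fm_code cs))" for q a
      using that Ev_const unfolding mem fm_code_eq_iff tm_code_eq_iff evident_def
      by blast
    have forces: "forced G w a" if "codes_mem (pe 0 (pe w a)) (list_encode (map lfm_code gs))" for a
      using that GD(1) unfolding mem lfm_code_eq_iff forced_def by blast
    have not_forces: "forced D w a" if "codes_mem (pe 0 (pe w a)) (list_encode (map lfm_code ds))" for a
      using that GD(2) unfolding mem lfm_code_eq_iff forced_def by blast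
    have rel: "Rel v w \<in> G" if "codes_mem (pe 1 (pe v w)) (list_encode (map lfm_code gs))" for v
      using that GD(1) unfolding mem lfm_code_eq_iff by blast
    have not_rel: "Rel v w \<notin> G" if "codes_mem (pe 1 (pe v w)) (list_encode (map lfm_code ds))" for v
      using that GD(2) Rel_clash unfolding mem lfm_code_eq_iff by blast
    have ev: "evident G w t a"
      if "codes_mem (pe 2 (pe w (pe t a))) (list_encode (map lfm_code gs))" for t a
      using that GD(1) tm_code_inject unfolding mem lfm_code_eq_iff evident_def by blast
    have not_ev: "\<not> evident G w t a"
      if "codes_mem (pe 2 (pe w (pe t a))) (list_encode (map lfm_code ds))" for t a
      using that GD(2) fm_code_inject Ev_clash
      unfolding mem lfm_code_eq_iff evident_def by blast
    show ?thesis
      unfolding input_ok_def item_iff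
      using const_less cs forces not_forces rel not_rel ev not_ev by blast
  qed
  moreover have "\<exists>w\<in>set_decode W. itM w l" if "l < n" for l
    using that unfolding W by (auto simp: item_iff)
  ultimately have "quasi_model n (list_encode (map fm_code cs))
    (list_encode (map lfm_code gs)) (list_encode (map lfm_code ds)) W"
    unfolding quasi_model_def
    using prop_ok_wtype ev_ok_wtype modal_ok_wtype[OF W] unfolding W by auto
  then show ?thesis using \<open>W < _\<close> by blast
qed

lemma refutable_iff:
  assumes "instance_code n (CS, \<Gamma>, \<Delta>)"
  shows "refutable n \<longleftrightarrow> \<not> G3S4LP CS \<Gamma> \<Delta>"
proof -
  obtain cs gs ds where eq: "CS = set cs" "\<Gamma> = mset gs" "\<Delta> = mset ds"
    and n: "n = list_encode [list_encode (map fm_code cs),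
      list_encode (map lfm_code gs), list_encode (map lfm_code ds)]"
    using assms unfolding instance_code_def by auto
  let ?c = "list_encode (map fm_code cs)" and ?g = "list_encode (map lfm_code gs)"
    and ?d = "list_encode (map lfm_code ds)"
  have less: "?c < n" "?g < n" "?d < n" unfolding n by (rule set_less_list_encode; simp)+
  have n': "n = Suc (pe c (Suc (pe g (Suc (pe d 0))))) \<longleftrightarrow> c = ?c \<and> g = ?g \<and> d = ?d" for c g d
    by (auto simp: n)
  have "refutable n \<longleftrightarrow> (\<exists>W < 2 ^ (2 ^ item_bound n). quasi_model n ?c ?g ?d W)"
    unfolding refutable_def n' using less by blast
  moreover have "\<not> G3S4LP CS \<Gamma> \<Delta>" if "quasi_model n ?c ?g ?d W" for W
    unfolding eq using quasi_model_not_derivable[OF that _ _ _ _ refl refl refl] less by simp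
  ultimately show ?thesis using quasi_model_exists[of cs gs ds n] less unfolding eq by auto
qed

theorem theorem10p12:
  "decidable instance_code
     {(CS, \<Gamma>, \<Delta>). finite CS \<and> constant_specification CS}
     (\<lambda>(CS, \<Gamma>, \<Delta>). G3S4LP CS \<Gamma> \<Delta>)"
proof (rule decidable_if_not_refutable, clarify)
  fix n CS \<Gamma> \<Delta> assume "instance_code n (CS, \<Gamma>, \<Delta>)"
  then show "G3S4LP CS \<Gamma> \<Delta> \<longleftrightarrow> \<not> refutable n" using refutable_iff by blast
qed

end
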